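(* Let $g\ge 1$ and $Q\in\mathfrak{J}_g^{\rm trop}$. Then the theta matroid $M(Q)$ is cographic, i.e. there is a connected graph $G$ whose edges are labeled bijectively by the vectors $v\in(\mathbb{Z}/2\mathbb{Z})^g\setminus\{0\}$ with $\vartheta_v(Q)\neq 0$ and whose cographic matroid is $M(Q)$. Moreover, if in such a graph $G$ we assign the length $2^{3-g}\cdot\vartheta_v(Q)$ to the edge labeled $v$, then these lengths are positive and the resulting metric graph has Riemann matrix $Q$ (with respect to a suitable basis of $H_1(G,\mathbb{Z})$).
   Context: $\mathfrak{H}_g^{\rm trop}$ is the cone of real symmetric positive definite $g\times g$ matrices. Metric graphs and Riemann matrices. A metric graph $\Gamma=(V,E,l)$ is a finite connected graph $G=(V,E)$ (loops and parallel edges allowed) with a length function $l:E\to\mathbb{R}_{>0}$. Its genus is $g=|E|-|V|+1$. Orient the edges and fix a $\mathbb{Z}$-basis of $H_1(G,\mathbb{Z})\simeq\mathbb{Z}^g$. Let $B$ be the $g\times|E|$ integer matrix whose column for an edge $e$ records the coefficients of $e$ in the basis vectors, and let $D$ be the $|E|\times|E|$ diagonal matrix of edge lengths. The Riemann matrix of $\Gamma$ with respect to this basis is $Q_\Gamma=BDB^t$; changing the basis corresponds to $Q_\Gamma\mapsto S^tQ_\Gamma S$ with $S\in\mathrm{GL}_g(\mathbb{Z})$. The tropical Schottky locus $\mathfrak{J}_g^{\rm trop}\subset\mathfrak{H}_g^{\rm trop}$ is the set of all matrices $BDB^t$ obtained this way, as $\Gamma$ runs over all metric graphs of genus $g$ and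 $B$ over all their cycle bases. The cographic matroid of $G$ is the matroid on $E$ represented by the columns of $B$ (the dual of the graphic matroid of $G$). Tropical theta constants. For $Q\in\mathfrak{H}_g^{\rm trop}$ and $x\in\mathbb{R}^g$ let $$\Theta(Q,x)=\max_{\lambda\in\mathbb{Z}^g}\Bigl\{\lambda^tQx-\tfrac12\lambda^tQ\lambda\Bigr\},$$ and for $u\in\mathbb{Z}^g$ let $$\Theta_u(Q)=2\cdot\Theta\bigl(Q,\tfrac u2\bigr)-\tfrac14u^tQu ,$$ which depends only on $u$ modulo $2$. For $v\in\mathbb{Z}^g$ (depending only on $v$ modulo $2$) let $$\vartheta_v(Q)=\sum_{u\in(\mathbb{Z}/2\mathbb{Z})^g}(-1)^{u^tv}\,\Theta_u(Q).$$ The theta matroid $M(Q)$ is the binary matroid (matroid of linear dependencies over $\mathbb{Z}/2\mathbb{Z}$) represented by the collection of vectors $\{v\in(\mathbb{Z}/2\mathbb{Z})^g\setminus\{0\}:\vartheta_v(Q)\ne0\}$. *)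

theory Defs
  imports
    "HOL-Analysis.Analysis"
    "HOL-Library.Z2"
    "Graph_Theory.Digraph_Component"
begin

section \<open>Matroids represented by matrices\<close>

text \<open>A matroid is given by its ground set together with its family of independent sets.\<close>

type_synonym 'e matroid = "'e set \<times> 'e set set"

text \<open>
  The matroid on the finite set \<open>E\<close> represented over the field \<open>'k\<close> by the columns of the matrix
  \<open>A\<close> with rows \<open>J\<close> and columns \<open>E\<close>. Independence is that of the \<^emph>\<open>family\<close> of columns, so zero
  columns are loops and equal columns are parallel.
\<close>

definition represented_matroid ::
  "'i set \<Rightarrow> 'e set \<Rightarrow> ('i \<Rightarrow> 'e \<Rightarrow> 'k::field) \<Rightarrow> 'e matroid" where
  "represented_matroid J E A =
     (E, {I. I \<subseteq> E \<and>
             (\<forall>c. (\<forall>j\<in>J. (\<Sum>e\<in>I. c e * A j e) = 0) \<longrightarrow> (\<forall>e\<in>I. c e = 0))})"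

definition relabel_matroid :: "('e \<Rightarrow> 'f) \<Rightarrow> 'e matroid \<Rightarrow> 'f matroid" where
  "relabel_matroid f M = (f ` fst M, (\<lambda>I. f ` I) ` snd M)"

section \<open>Graphs, cycle bases and Riemann matrices\<close>

text \<open>
  A finite graph with loops and parallel edges, with a chosen orientation of its edges, is a
  finite multi-digraph of the AFP entry \<^emph>\<open>Graph Theory\<close>; its notion of connectedness ignores the
  orientation and includes having at least one vertex.
\<close>

definition connected_graph :: "('v, 'e) pre_digraph \<Rightarrow> bool" where
  "connected_graph G \<longleftrightarrow> fin_digraph G \<and> Digraph_Component.connected G"

text \<open>A connected graph has at most \<open>|E| + 1\<close> vertices, so the subtraction does not truncate.\<close>

definition genus :: "('v, 'e) pre_digraph \<Rightarrow> nat" where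
  "genus G = card (arcs G) + 1 - card (verts G)"

text \<open>\<open>H\<^sub>1(G, \<int>)\<close> is the kernel of the boundary map \<open>\<int>\<^sup>E \<rightarrow> \<int>\<^sup>V\<close>.\<close>

definition H1 :: "('v, 'e) pre_digraph \<Rightarrow> ('e \<Rightarrow> int) set" where
  "H1 G = {z. (\<forall>e. e \<notin> arcs G \<longrightarrow> z e = 0) \<and>
              (\<forall>v\<in>verts G. (\<Sum>e\<in>in_arcs G v. z e) = (\<Sum>e\<in>out_arcs G v. z e))}"

text \<open>
  The family \<open>(B j)\<close>, \<open>j \<in> J\<close>, is a \<open>\<int>\<close>-basis of \<open>H\<^sub>1(G, \<int>)\<close>. Read as a matrix, \<open>B\<close> has the basis
  vectors as its rows, hence the coefficients of the edge \<open>e\<close> as its column \<open>e\<close>.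
\<close>

definition cycle_basis :: "('v, 'e) pre_digraph \<Rightarrow> 'i set \<Rightarrow> ('i \<Rightarrow> 'e \<Rightarrow> int) \<Rightarrow> bool" where
  "cycle_basis G J B \<longleftrightarrow>
     finite J \<and> (\<forall>j\<in>J. B j \<in> H1 G) \<and>
     (\<forall>z\<in>H1 G. \<exists>!c. (\<forall>j. j \<notin> J \<longrightarrow> c j = 0) \<and> z = (\<lambda>e. \<Sum>j\<in>J. c j * B j e))"

text \<open>
  The rows of \<open>B\<close> are indexed here by \<open>{..<genus G}\<close>, so that the matroid is defined for every
  graph independently of the type-level dimension \<open>'g\<close> used below. Which basis is taken does not
  matter, see \<open>represented_matroid_cycle_basis\<close>.
\<close>

definition cographic_matroid :: "('v, 'e) pre_digraph \<Rightarrow> 'e matroid" where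
  "cographic_matroid G =
     (arcs G, {I. \<exists>B. cycle_basis G {..<genus G} B \<and>
        I \<in> snd (represented_matroid {..<genus G} (arcs G) (\<lambda>j e. real_of_int (B j e)))})"

lemma cycle_basis_relations:
  assumes B: "cycle_basis G J B" and B': "cycle_basis G J' B'"
    and rel: "\<forall>j\<in>J. (\<Sum>e\<in>I. c e * real_of_int (B j e)) = 0"
  shows "\<forall>j\<in>J'. (\<Sum>e\<in>I. c e * real_of_int (B' j e)) = 0"
proof
  fix j assume "j \<in> J'"
  then have "B' j \<in> H1 G"
    using B' by (auto simp: cycle_basis_def)
  then obtain d where d: "B' j = (\<lambda>e. \<Sum>i\<in>J. d i * B i e)"
    using B unfolding cycle_basis_def by blast
  have "(\<Sum>e\<in>I. c e * real_of_int (B' j e))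
      = (\<Sum>e\<in>I. \<Sum>i\<in>J. real_of_int (d i) * (c e * real_of_int (B i e)))"
    unfolding d of_int_sum of_int_mult sum_distrib_left
    by (intro sum.cong refl) (simp only: mult.left_commute)
  also have "\<dots> = (\<Sum>i\<in>J. real_of_int (d i) * (\<Sum>e\<in>I. c e * real_of_int (B i e)))"
    unfolding sum_distrib_left by (rule sum.swap)
  finally show "(\<Sum>e\<in>I. c e * real_of_int (B' j e)) = 0"
    using rel by (metis (no_types, lifting) mult_zero_right sum.neutral)
qed

lemma represented_matroid_cycle_basis:
  assumes "cycle_basis G J B" and "cycle_basis G J' B'"
  shows "represented_matroid J (arcs G) (\<lambda>j e. real_of_int (B j e)) =
         represented_matroid J' (arcs G) (\<lambda>j e. real_of_int (B' j e))"
proof -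
  have "(\<forall>j\<in>J. (\<Sum>e\<in>I. c e * real_of_int (B j e)) = 0) \<longleftrightarrow>
        (\<forall>j\<in>J'. (\<Sum>e\<in>I. c e * real_of_int (B' j e)) = 0)" for c I
    by (rule iffI) (fact cycle_basis_relations[OF assms] cycle_basis_relations[OF assms(2,1)])+
  then show ?thesis
    by (simp add: represented_matroid_def)
qed

lemma cographic_matroid_eq:
  assumes "cycle_basis G {..<genus G} B"
  shows "cographic_matroid G =
         represented_matroid {..<genus G} (arcs G) (\<lambda>j e. real_of_int (B j e))"
proof -
  let ?M = "\<lambda>B. represented_matroid {..<genus G} (arcs G) (\<lambda>j e. real_of_int (B j e))"
  have "(\<exists>B'. cycle_basis G {..<genus G} B' \<and> I \<in> snd (?M B')) \<longleftrightarrow> I \<in> snd (?M B)" for I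
  proof
    assume "\<exists>B'. cycle_basis G {..<genus G} B' \<and> I \<in> snd (?M B')"
    then obtain B' where B': "cycle_basis G {..<genus G} B'" and "I \<in> snd (?M B')"
      by (elim exE conjE)
    then show "I \<in> snd (?M B)"
      by (simp only: represented_matroid_cycle_basis[OF B' assms])
  next
    assume "I \<in> snd (?M B)"
    with assms show "\<exists>B'. cycle_basis G {..<genus G} B' \<and> I \<in> snd (?M B')"
      by (intro exI conjI)
  qed
  then have "cographic_matroid G = (arcs G, snd (?M B))"
    unfolding cographic_matroid_def by simp
  moreover have "fst (?M B) = arcs G"
    by (simp add: represented_matroid_def)
  ultimately show ?thesis
    by (metis prod.collapse)
qed

definition metric_graph :: "('v, 'e) pre_digraph \<Rightarrow> ('e \<Rightarrow> real) \<Rightarrow> bool" where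
  "metric_graph G l \<longleftrightarrow> connected_graph G \<and> (\<forall>e\<in>arcs G. 0 < l e)"

text \<open>The product \<open>B D B\<^sup>t\<close>, where \<open>D\<close> is the diagonal matrix of edge lengths.\<close>

definition riemann_matrix ::
  "('v, 'e) pre_digraph \<Rightarrow> ('e \<Rightarrow> real) \<Rightarrow> ('g \<Rightarrow> 'e \<Rightarrow> int) \<Rightarrow> real^'g^'g" where
  "riemann_matrix G l B =
     (\<chi> i j. \<Sum>e\<in>arcs G. real_of_int (B i e) * l e * real_of_int (B j e))"

definition has_riemann_matrix ::
  "('v, 'e) pre_digraph \<Rightarrow> ('e \<Rightarrow> real) \<Rightarrow> real^'g^'g \<Rightarrow> bool" where
  "has_riemann_matrix G l Q \<longleftrightarrow>
     metric_graph G l \<and> genus G = CARD('g) \<and>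
     (\<exists>B :: 'g \<Rightarrow> 'e \<Rightarrow> int. cycle_basis G UNIV B \<and> riemann_matrix G l B = Q)"

text \<open>
  The graphs being finite, it is no restriction to take their vertices and edges in \<open>nat\<close>.
  All these matrices are positive definite, since the rows of \<open>B\<close> are linearly independent.
\<close>

definition tropical_schottky_locus :: "(real^'g^'g) set" where
  "tropical_schottky_locus = {Q. \<exists>(G :: (nat, nat) pre_digraph) l. has_riemann_matrix G l Q}"

section \<open>Tropical theta constants\<close>

definition real_vec :: "int^'g \<Rightarrow> real^'g" where
  "real_vec u = (\<chi> i. real_of_int (u $ i))"

text \<open>The supremum is a maximum for positive definite \<open>Q\<close>.\<close>

definition trop_theta :: "real^'g^'g \<Rightarrow> real^'g \<Rightarrow> real" where
  "trop_theta Q x =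
     (SUP k :: int^'g. real_vec k \<bullet> (Q *v x) - 1/2 * (real_vec k \<bullet> (Q *v real_vec k)))"

definition theta_char :: "real^'g^'g \<Rightarrow> int^'g \<Rightarrow> real" where
  "theta_char Q u =
     2 * trop_theta Q ((1/2) *\<^sub>R real_vec u) - 1/4 * (real_vec u \<bullet> (Q *v real_vec u))"

instance bit :: finite
proof
  have "(UNIV :: bit set) \<subseteq> {0, 1}"
    by (metis bit_not_zero_iff insert_iff subsetI)
  then show "finite (UNIV :: bit set)"
    by (rule finite_subset) simp
qed

text \<open>The representative with entries in \<open>{0, 1}\<close> of a vector modulo 2.\<close>

definition lift_bits :: "bit^'g \<Rightarrow> int^'g" where
  "lift_bits u = (\<chi> i. of_bit (u $ i))"

definition theta_const :: "real^'g^'g \<Rightarrow> int^'g \<Rightarrow> real" where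
  "theta_const Q v =
     (\<Sum>u :: bit^'g \<in> UNIV. (-1) powi (\<Sum>i\<in>UNIV. lift_bits u $ i * v $ i) * theta_char Q (lift_bits u))"

section \<open>The theta matroid\<close>

definition theta_support :: "real^'g^'g \<Rightarrow> (bit^'g) set" where
  "theta_support Q = {v. v \<noteq> 0 \<and> theta_const Q (lift_bits v) \<noteq> 0}"

definition theta_matroid :: "real^'g^'g \<Rightarrow> (bit^'g) matroid" where
  "theta_matroid Q = represented_matroid UNIV (theta_support Q) (\<lambda>i v. v $ i)"

text \<open>
  \<open>G\<close> is a connected graph whose edges are labelled bijectively, via \<open>lab\<close>, by the vectors with
  nonzero theta constant and whose cographic matroid is, in terms of these labels, \<open>M(Q)\<close>.
\<close>

definition theta_labelled_graph ::
  "real^'g^'g \<Rightarrow> ('v, 'e) pre_digraph \<Rightarrow> ('e \<Rightarrow> bit^'g) \<Rightarrow> bool" where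
  "theta_labelled_graph Q G lab \<longleftrightarrow>
     connected_graph G \<and> bij_betw lab (arcs G) (theta_support Q) \<and>
     relabel_matroid lab (cographic_matroid G) = theta_matroid Q"

definition theta_length :: "real^'g^'g \<Rightarrow> bit^'g \<Rightarrow> real" where
  "theta_length Q v = 2 powi (3 - int CARD('g)) * theta_const Q (lift_bits v)"

end

theory Submission
  imports Defs
begin

text \<open>
  Let \<open>Q = B D B\<^sup>t\<close> be the Riemann matrix of a metric graph with edge lengths \<open>l e\<close> and let \<open>b\<^sub>e\<close> be the
  column of \<open>e\<close> in \<open>B\<close>. Completing the square, \<open>\<Theta>\<^sub>u(Q)\<close> is \<open>-1/4\<close> times the minimum of
  \<open>\<Sum>e. l e * (w \<bullet> b\<^sub>e)\<^sup>2\<close> over all \<open>w\<close> congruent to \<open>u\<close> modulo 2. Every summand is at least \<open>l e\<close> when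
  \<open>u \<bullet> b\<^sub>e\<close> is odd, and one \<open>w\<close> attains all these bounds: the cycle with coordinates \<open>u\<close> is odd on the
  edges of a subgraph with even degrees, and orienting this subgraph in a balanced way gives a cycle
  with the same parities and all entries in \<open>{-1, 0, 1}\<close>. Fourier inversion over
  \<open>(\<int>/2\<int>)\<^sup>g\<close> then shows that \<open>2\<^sup>3\<^sup>-\<^sup>g \<vartheta>\<^sub>v(Q)\<close> is, for \<open>v \<noteq> 0\<close>, the total length of the edges \<open>e\<close> with
  \<open>b\<^sub>e\<close> congruent to \<open>v\<close> modulo 2 (\<open>theta_length_riemann\<close>).

  The orientation argument says that cycles can be halved: for every cycle \<open>z\<close> there is a cycle \<open>y\<close>
  with \<open>\<bar>z e - 2 * y e\<bar> \<le> 1\<close> for all edges \<open>e\<close>. This closure property of the lattice of cycles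
  (\<open>halving_lattice\<close>) is the only form in which unimodularity enters, and it has three further
  consequences.

  First, a set of columns is independent over any field if and only if the lattice restricts onto
  all integer vectors on this set (\<open>independent_columns_iff_shattered\<close>). Hence the cographic
  matroid, defined over the reals, is also the matroid of the columns modulo 2.

  Second, columns that are congruent modulo 2 are equal up to sign, and columns that are zero
  modulo 2 are zero. Edges with such columns can be contracted, adding up the lengths
  of parallel ones; so \<open>Q\<close> comes from a graph with distinct nonzero columns modulo 2
  (\<open>reduced_graph_exists\<close>). For this graph, labelling each edge by its column modulo 2 has all
  the required properties.

  Third, such a lattice is determined up to signs of its coordinates by its matroid
  (\<open>lattice_determined_up_to_signs\<close>). So for any other labelled graph, a basis of the reduced graph
  becomes a basis of its cycles after sign changes, and these do not affect \<open>B D B\<^sup>t\<close>. In particular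
  its genus is \<open>g\<close> and its Riemann matrix is \<open>Q\<close>.
\<close>

section \<open>Lattices closed under halving\<close>

text \<open>
  Closure under halving up to an error in \<open>{-1, 0, 1}\<close> is all that is used of the unimodularity of a
  cycle lattice: it refers to no basis, it survives signed pullbacks, and each use of it below
  replaces a determinant argument. Vectors are total functions that vanish
  outside \<open>E\<close>, so that equality of vectors is equality of functions.
\<close>

locale halving_lattice =
  fixes E :: "'e set" and L :: "('e \<Rightarrow> int) set"
  assumes finite_E: "finite E"
    and outside: "z \<in> L \<Longrightarrow> e \<notin> E \<Longrightarrow> z e = 0"
    and zero: "(\<lambda>_. 0) \<in> L"
    and add: "x \<in> L \<Longrightarrow> y \<in> L \<Longrightarrow> (\<lambda>e. x e + y e) \<in> L"
    and scale: "x \<in> L \<Longrightarrow> (\<lambda>e. a * x e) \<in> L"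
    and halve: "z \<in> L \<Longrightarrow> \<exists>y\<in>L. \<forall>e. \<bar>z e - 2 * y e\<bar> \<le> 1"

text \<open>
  The restriction of \<open>L\<close> to \<open>I\<close> is all of \<open>\<int>\<^sup>I\<close>. In terms of a basis matrix of \<open>L\<close> this is independence
  of the columns in \<open>I\<close>, over every field at once; see \<open>independent_columns_iff_shattered\<close>.
\<close>

definition shattered :: "('e \<Rightarrow> int) set \<Rightarrow> 'e set \<Rightarrow> bool" where
  "shattered L I \<longleftrightarrow> (\<forall>e\<in>I. \<exists>z\<in>L. \<forall>f\<in>I. z f = of_bool (f = e))"

context halving_lattice
begin

lemma add_scaled: "x \<in> L \<Longrightarrow> y \<in> L \<Longrightarrow> (\<lambda>e. x e + a * y e) \<in> L"
  by (rule add[of x "\<lambda>e. a * y e"]) (auto intro: scale)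

lemma combination:
  assumes "finite I" and "\<And>i. i \<in> I \<Longrightarrow> r i \<in> L"
  shows "(\<lambda>e. \<Sum>i\<in>I. a i * r i e) \<in> L"
  using assms
proof (induction I)
  case empty
  then show ?case by (simp add: zero)
next
  case (insert i I)
  then have "(\<lambda>e. (\<Sum>i\<in>I. a i * r i e) + a i * r i e) \<in> L"
    by (intro add_scaled) auto
  then show ?case
    using insert by (simp add: add.commute)
qed

lemma reduce:
  assumes "z \<in> L"
  obtains x where "x \<in> L" and "\<And>e. \<bar>x e\<bar> \<le> 1" and "\<And>e. even (x e) \<longleftrightarrow> even (z e)"
proof -
  obtain y where y: "y \<in> L" "\<forall>e. \<bar>z e - 2 * y e\<bar> \<le> 1"
    using halve[OF assms] by blast
  let ?x = "\<lambda>e. z e + (-2) * y e"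
  have "?x \<in> L"
    using add_scaled[OF assms y(1)] .
  then show thesis
    using y(2) by (intro that[of ?x]) auto
qed

text \<open>
  A vector with entries in \<open>{-1, 0, 1}\<close> is determined on \<open>I\<close>, up to a global sign, by its parities
  there as soon as only one of them is odd; so unit vectors may be looked for modulo 2.
\<close>

lemma unit_vector_from_parity:
  assumes "z \<in> L" "e \<in> I" and z: "\<forall>f\<in>I. odd (z f) \<longleftrightarrow> f = e"
  shows "\<exists>x. x \<in> L \<and> (\<forall>f\<in>I. x f = of_bool (f = e)) \<and> (\<forall>f. \<bar>x f\<bar> \<le> 1)"
proof -
  obtain x where x: "x \<in> L" "\<And>e. \<bar>x e\<bar> \<le> 1" "\<And>e. even (x e) \<longleftrightarrow> even (z e)"
    using reduce[OF assms(1)] by blast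
  have trit: "x f = -1 \<or> x f = 0 \<or> x f = 1" for f
    using x(2)[of f] by arith
  have "x e * x f = of_bool (f = e)" if "f \<in> I" for f
  proof -
    have "odd (x f) \<longleftrightarrow> f = e"
      using x(3)[of f] z that by simp
    then show ?thesis
      using trit[of f] by auto
  qed
  moreover have "\<bar>x e * x f\<bar> \<le> 1" for f
    using trit[of e] trit[of f] by auto
  ultimately show ?thesis
    by (intro exI[of _ "\<lambda>f. x e * x f"] conjI scale x(1)) auto
qed

lemma shattered_parityI:
  assumes "\<And>e. e \<in> I \<Longrightarrow> \<exists>z\<in>L. \<forall>f\<in>I. odd (z f) \<longleftrightarrow> f = e"
  shows "shattered L I"
  unfolding shattered_def
proof
  fix e assume e: "e \<in> I"
  then obtain z where "z \<in> L" "\<forall>f\<in>I. odd (z f) \<longleftrightarrow> f = e"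
    using assms by blast
  then show "\<exists>z\<in>L. \<forall>f\<in>I. z f = of_bool (f = e)"
    using unit_vector_from_parity[OF _ e] by blast
qed

lemma shattered_unit:
  assumes "shattered L I" "e \<in> I"
  shows "\<exists>z. z \<in> L \<and> (\<forall>f\<in>I. z f = of_bool (f = e)) \<and> (\<forall>f. \<bar>z f\<bar> \<le> 1)"
proof -
  obtain z where z: "z \<in> L" "\<forall>f\<in>I. z f = of_bool (f = e)"
    using assms unfolding shattered_def by blast
  then have "\<forall>f\<in>I. odd (z f) \<longleftrightarrow> f = e"
    by simp
  then show ?thesis
    using unit_vector_from_parity[OF z(1) assms(2)] by blast
qed

text \<open>
  Halving keeps the zeros of \<open>z\<close> on \<open>I\<close> and roughly halves \<open>z a\<close>. Iterated, it would turn a nonzero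
  value at \<open>a\<close> into \<open>\<plusminus>1\<close>, which would make \<open>insert a I\<close> shattered.
\<close>

lemma vanish_outside_shattered:
  assumes I: "shattered L I" and a: "\<not> shattered L (insert a I)"
    and "z \<in> L" "\<forall>f\<in>I. z f = 0"
  shows "z a = 0"
  using assms(3,4)
proof (induction "nat \<bar>z a\<bar>" arbitrary: z rule: less_induct)
  case less
  have "a \<notin> I"
    using I a by (auto simp: insert_absorb)
  obtain y where y: "y \<in> L" "\<forall>e. \<bar>z e - 2 * y e\<bar> \<le> 1"
    using halve[OF less.prems(1)] by blast
  have y0: "\<forall>f\<in>I. y f = 0"
  proof
    fix f assume "f \<in> I"
    then show "y f = 0"
      using y(2)[rule_format, of f] less.prems(2) by auto
  qed
  show "z a = 0"
  proof (rule ccontr)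
    assume nz: "z a \<noteq> 0"
    show False
    proof (cases "\<bar>z a\<bar> = 1")
      case True
      let ?u = "\<lambda>e. z a * z e"
      have u: "?u \<in> L" "?u a = 1" "\<forall>f\<in>I. ?u f = 0"
        using scale[OF less.prems(1)] True less.prems(2) by (auto simp: abs_if split: if_splits)
      have "shattered L (insert a I)"
        unfolding shattered_def
      proof
        fix e assume e: "e \<in> insert a I"
        show "\<exists>w\<in>L. \<forall>f\<in>insert a I. w f = of_bool (f = e)"
        proof (cases "e = a")
          case True
          then show ?thesis
            using u \<open>a \<notin> I\<close> by (intro bexI[of _ ?u]) auto
        next
          case False
          then obtain w where w: "w \<in> L" "\<forall>f\<in>I. w f = of_bool (f = e)"
            using e I unfolding shattered_def by blast
          have "(\<lambda>f. w f + (- w a) * ?u f) \<in> L"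
            using add_scaled[OF w(1) u(1)] .
          then show ?thesis
            using w(2) u(2,3) False by (intro bexI[of _ "\<lambda>f. w f + (- w a) * ?u f"]) auto
        qed
      qed
      then show False
        using a by blast
    next
      case False
      have "nat \<bar>y a\<bar> < nat \<bar>z a\<bar>" and "y a \<noteq> 0"
        using y(2)[rule_format, of a] nz False by linarith+
      then show False
        using less.hyps[OF _ y(1) y0] by blast
    qed
  qed
qed

lemma maximal_shattered:
  assumes "finite I"
  obtains T where "T \<subseteq> I" "shattered L T" "\<And>a. a \<in> I - T \<Longrightarrow> \<not> shattered L (insert a T)"
proof -
  let ?S = "{T. T \<subseteq> I \<and> shattered L T}"
  have "finite ?S" "{} \<in> ?S"
    using assms by (auto simp: shattered_def)
  then obtain T where T: "T \<in> ?S" "\<forall>U\<in>?S. T \<subseteq> U \<longrightarrow> U = T"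
    using finite_has_maximal[of ?S] by (metis (no_types, lifting) empty_iff)
  show thesis
  proof (rule that)
    show "T \<subseteq> I" "shattered L T"
      using T(1) by auto
    fix a assume "a \<in> I - T"
    then show "\<not> shattered L (insert a T)"
      using T by blast
  qed
qed

text \<open>
  The relation comes from a maximal shattered subset \<open>T\<close> of \<open>I\<close>: the coefficients are the values at \<open>a\<close>
  of vectors restricting to the unit vectors on \<open>T\<close>, which explains their bound. One integral
  relation serves as a linear dependence over every field, because its coefficient at \<open>a\<close> is a unit.
\<close>

lemma dependent_relation:
  assumes "finite I" and "\<not> shattered L I"
  shows "\<exists>a c. a \<in> I \<and> (\<forall>k. \<bar>c k\<bar> \<le> (1::int)) \<and> (\<forall>z\<in>L. z a = (\<Sum>k\<in>I - {a}. c k * z k))"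
proof -
  obtain T where T: "T \<subseteq> I" "shattered L T" "\<And>a. a \<in> I - T \<Longrightarrow> \<not> shattered L (insert a T)"
    using maximal_shattered[OF assms(1)] by blast
  have "T \<noteq> I"
    using T(2) assms(2) by auto
  then obtain a where a: "a \<in> I - T"
    using T(1) by blast
  have finT: "finite T"
    using T(1) assms(1) finite_subset by blast
  have "\<forall>k\<in>T. \<exists>z. z \<in> L \<and> (\<forall>f\<in>T. z f = of_bool (f = k)) \<and> (\<forall>f. \<bar>z f\<bar> \<le> 1)"
    using shattered_unit[OF T(2)] by blast
  from bchoice[OF this] obtain r where
    r: "\<And>k. k \<in> T \<Longrightarrow> r k \<in> L" "\<And>k f. k \<in> T \<Longrightarrow> f \<in> T \<Longrightarrow> r k f = of_bool (f = k)"
      "\<And>k f. k \<in> T \<Longrightarrow> \<bar>r k f\<bar> \<le> 1"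
    by blast
  define c where "c k = (if k \<in> T then r k a else 0)" for k
  have rel: "z a = (\<Sum>k\<in>I - {a}. c k * z k)" if z: "z \<in> L" for z
  proof -
    let ?w = "\<lambda>e. z e + (-1) * (\<Sum>k\<in>T. z k * r k e)"
    have "?w \<in> L"
      by (intro add_scaled combination z finT r)
    moreover have "?w f = 0" if "f \<in> T" for f
    proof -
      have "(\<Sum>k\<in>T. z k * r k f) = (\<Sum>k\<in>T. if k = f then z k else 0)"
        using that by (intro sum.cong refl) (auto simp: r(2))
      then show ?thesis
        using that finT by simp
    qed
    ultimately have "?w a = 0"
      using vanish_outside_shattered[OF T(2) T(3)[OF a]] by blast
    then have "z a = (\<Sum>k\<in>T. c k * z k)"
      by (simp add: c_def mult.commute)
    also have "\<dots> = (\<Sum>k\<in>I - {a}. c k * z k)"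
      by (rule sum.mono_neutral_left) (use assms(1) T(1) a in \<open>auto simp: c_def\<close>)
    finally show ?thesis .
  qed
  show ?thesis
  proof (intro exI[of _ a] exI[of _ c] conjI allI ballI)
    show "a \<in> I"
      using a by blast
    show "\<bar>c k\<bar> \<le> 1" for k
      using r(3) by (simp add: c_def)
  qed (rule rel)
qed

end

text \<open>
  The set \<open>T\<close> is a basis of the matroid of \<open>L\<close>, and the rows \<open>r i\<close> are the standard form \<open>(I | A)\<close> of a
  basis matrix of \<open>L\<close>.
\<close>

locale fundamental_vectors = halving_lattice +
  fixes T :: "'a set" and r :: "'a \<Rightarrow> 'a \<Rightarrow> int"
  assumes T_sub: "T \<subseteq> E"
    and T_shattered: "shattered L T"
    and T_maximal: "a \<in> E - T \<Longrightarrow> \<not> shattered L (insert a T)"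
    and r_mem: "i \<in> T \<Longrightarrow> r i \<in> L"
    and r_unit: "i \<in> T \<Longrightarrow> f \<in> T \<Longrightarrow> r i f = of_bool (f = i)"
    and r_small: "i \<in> T \<Longrightarrow> \<bar>r i f\<bar> \<le> 1"
begin

lemma finite_T: "finite T"
  using T_sub finite_E finite_subset by blast

lemma sum_unit: "f \<in> T \<Longrightarrow> (\<Sum>k\<in>T. a k * r k f) = a f"
proof -
  assume f: "f \<in> T"
  have "(\<Sum>k\<in>T. a k * r k f) = (\<Sum>k\<in>T. if k = f then a k else 0)"
    using f by (intro sum.cong refl) (auto simp: r_unit)
  then show ?thesis
    using f finite_T by simp
qed

lemma expansion:
  assumes "z \<in> L"
  shows "z e = (\<Sum>i\<in>T. z i * r i e)"
proof (cases "e \<in> E - T")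
  case True
  let ?w = "\<lambda>e. z e + (-1) * (\<Sum>k\<in>T. z k * r k e)"
  have "?w \<in> L"
    by (intro add_scaled combination assms finite_T r_mem)
  moreover have "\<forall>f\<in>T. ?w f = 0"
    by (simp add: sum_unit)
  ultimately have "?w e = 0"
    using vanish_outside_shattered[OF T_shattered T_maximal[OF True]] by blast
  then show ?thesis
    by simp
next
  case False
  then consider "e \<in> T" | "e \<notin> E" "e \<notin> T"
    by blast
  then show ?thesis
  proof cases
    case 1
    then show ?thesis by (simp add: sum_unit)
  next
    case 2
    then show ?thesis
      using outside[OF assms] outside[OF r_mem] by simp
  qed
qed

text \<open>
  The exchange of \<open>i\<close> for \<open>e\<close> is a pivot on the entry \<open>r i e\<close>, and for halving lattices it may be
  carried out modulo 2. So the matroid determines the standard form modulo 2.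
\<close>

lemma odd_entry_iff_exchange:
  assumes i: "i \<in> T" and e: "e \<in> E - T"
  shows "odd (r i e) \<longleftrightarrow> shattered L (insert e (T - {i}))"
proof
  assume odd: "odd (r i e)"
  show "shattered L (insert e (T - {i}))"
  proof (rule shattered_parityI)
    fix k assume k: "k \<in> insert e (T - {i})"
    show "\<exists>z\<in>L. \<forall>f\<in>insert e (T - {i}). odd (z f) \<longleftrightarrow> f = k"
    proof (cases "k = e")
      case True
      then show ?thesis
        using odd e i by (intro bexI[of _ "r i"] r_mem) (auto simp: r_unit)
    next
      case False
      then have kT: "k \<in> T" "k \<noteq> i"
        using k by auto
      have "(\<lambda>f. r k f + r k e * r i f) \<in> L"
        by (intro add_scaled r_mem kT i)
      then show ?thesis
        using odd e i kT by (intro bexI[of _ "\<lambda>f. r k f + r k e * r i f"]) (auto simp: r_unit)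
    qed
  qed
next
  assume "shattered L (insert e (T - {i}))"
  then obtain z where z: "z \<in> L" "\<forall>f\<in>insert e (T - {i}). z f = of_bool (f = e)"
    unfolding shattered_def by blast
  have "1 = (\<Sum>k\<in>T. z k * r k e)"
    using z(2) expansion[OF z(1), of e] by simp
  also have "\<dots> = (\<Sum>k\<in>T. if k = i then z i * r i e else 0)"
    using z(2) e by (intro sum.cong refl) auto
  also have "\<dots> = z i * r i e"
    using i finite_T by simp
  finally have "odd (z i * r i e)"
    by (metis odd_one)
  then show "odd (r i e)"
    by simp
qed

end

section \<open>Signed pullbacks\<close>

lemma unit_square: "\<bar>a\<bar> = 1 \<Longrightarrow> a * a = (1::int)"
  by (metis abs_mult_self_eq mult_1)

lemma unit_odd: "\<bar>a\<bar> = 1 \<Longrightarrow> odd (a::int)"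
  by (metis dvd_abs_iff odd_one)

text \<open>
  Relabelling the edges of a graph by \<open>p\<close> and reversing those with \<open>s e = -1\<close> acts on its cycles in this
  way. Coordinates outside \<open>E\<close> are set to 0 to keep the convention of \<open>halving_lattice\<close>.
\<close>

definition signed_pullback :: "('e \<Rightarrow> int) \<Rightarrow> ('e \<Rightarrow> 'f) \<Rightarrow> 'e set \<Rightarrow> ('f \<Rightarrow> int) \<Rightarrow> 'e \<Rightarrow> int" where
  "signed_pullback s p E z = (\<lambda>e. if e \<in> E then s e * z (p e) else 0)"

lemma halving_lattice_signed_pullback:
  assumes L: "halving_lattice F L" and E: "finite E" and s: "\<And>e. \<bar>s e\<bar> = 1"
  shows "halving_lattice E (signed_pullback s p E ` L)"
proof -
  interpret halving_lattice F L by fact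
  let ?f = "signed_pullback s p E"
  show ?thesis
  proof
    show "finite E" by fact
    show "z e = 0" if "z \<in> ?f ` L" "e \<notin> E" for z e
      using that by (auto simp: signed_pullback_def)
    have "?f (\<lambda>_. 0) = (\<lambda>_. 0)"
      by (simp add: signed_pullback_def fun_eq_iff)
    then show "(\<lambda>_. 0) \<in> ?f ` L"
      using imageI[OF zero, of ?f] by simp
    show "(\<lambda>e. x e + y e) \<in> ?f ` L" if xy: "x \<in> ?f ` L" "y \<in> ?f ` L" for x y
    proof -
      obtain x' where x': "x = ?f x'" "x' \<in> L" using xy(1) by (rule imageE)
      obtain y' where y': "y = ?f y'" "y' \<in> L" using xy(2) by (rule imageE)
      have "(\<lambda>e. x e + y e) = ?f (\<lambda>f. x' f + y' f)"
        by (auto simp: x' y' signed_pullback_def distrib_left)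
      then show ?thesis
        using add[OF x'(2) y'(2)] by simp
    qed
    show "(\<lambda>e. a * x e) \<in> ?f ` L" if x: "x \<in> ?f ` L" for a x
    proof -
      obtain x' where x': "x = ?f x'" "x' \<in> L" using x by (rule imageE)
      have "(\<lambda>e. a * x e) = ?f (\<lambda>f. a * x' f)"
        by (auto simp: x' signed_pullback_def)
      then show ?thesis
        using scale[OF x'(2), of a] by simp
    qed
    show "\<exists>y\<in>?f ` L. \<forall>e. \<bar>z e - 2 * y e\<bar> \<le> 1" if z: "z \<in> ?f ` L" for z
    proof -
      obtain z' where z': "z = ?f z'" "z' \<in> L" using z by (rule imageE)
      from halve[OF z'(2)] obtain y where y: "y \<in> L" "\<forall>f. \<bar>z' f - 2 * y f\<bar> \<le> 1"
        by (elim bexE)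
      have "\<bar>z e - 2 * ?f y e\<bar> \<le> 1" for e
      proof (cases "e \<in> E")
        case True
        then have "z e - 2 * ?f y e = s e * (z' (p e) - 2 * y (p e))"
          by (simp add: z'(1) signed_pullback_def algebra_simps)
        then show ?thesis
          using y(2) by (simp add: abs_mult s)
      qed (simp add: z'(1) signed_pullback_def)
      then show ?thesis
        using y(1) by blast
    qed
  qed
qed

lemma shattered_signed_pullback:
  assumes L: "halving_lattice F L" and E: "finite E" and s: "\<And>e. \<bar>s e\<bar> = 1"
    and I: "I \<subseteq> E" and inj: "inj_on p I"
  shows "shattered (signed_pullback s p E ` L) I \<longleftrightarrow> shattered L (p ` I)"
proof -
  interpret L: halving_lattice F L by fact
  interpret M: halving_lattice E "signed_pullback s p E ` L"
    by (rule halving_lattice_signed_pullback[OF L E s])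
  \<comment> \<open>Parities ignore the signs.\<close>
  have parity: "(\<forall>f\<in>I. odd (signed_pullback s p E z f) \<longleftrightarrow> f = e) \<longleftrightarrow>
      (\<forall>f\<in>p ` I. odd (z f) \<longleftrightarrow> f = p e)" if "e \<in> I" for z e
    using that I inj unit_odd[OF s]
    by (auto simp: signed_pullback_def inj_on_eq_iff subset_iff)
  show ?thesis
  proof
    assume I': "shattered (signed_pullback s p E ` L) I"
    show "shattered L (p ` I)"
    proof (rule L.shattered_parityI)
      fix f assume "f \<in> p ` I"
      then obtain e where e: "f = p e" "e \<in> I" by (rule imageE)
      then obtain z where "z \<in> L" "\<forall>f\<in>I. signed_pullback s p E z f = of_bool (f = e)"
        using I' unfolding shattered_def by blast
      then show "\<exists>z\<in>L. \<forall>g\<in>p ` I. odd (z g) \<longleftrightarrow> g = f"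
        unfolding e(1) parity[OF e(2), symmetric] by (intro bexI[of _ z]) simp_all
    qed
  next
    assume I': "shattered L (p ` I)"
    show "shattered (signed_pullback s p E ` L) I"
    proof (rule M.shattered_parityI)
      fix e assume e: "e \<in> I"
      then obtain z where z: "z \<in> L" "\<forall>f\<in>p ` I. z f = of_bool (f = p e)"
        using I' unfolding shattered_def by blast
      have "\<forall>f\<in>I. odd (signed_pullback s p E z f) \<longleftrightarrow> f = e"
        unfolding parity[OF e] using z(2) by simp
      then show "\<exists>z\<in>signed_pullback s p E ` L. \<forall>f\<in>I. odd (z f) \<longleftrightarrow> f = e"
        using z(1) by blast
    qed
  qed
qed

lemma inj_on_signed_pullback:
  assumes L: "halving_lattice F L" and s: "\<And>e. \<bar>s e\<bar> = 1" and p: "F \<subseteq> p ` E"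
  shows "inj_on (signed_pullback s p E) L"
proof (rule inj_onI, rule ext)
  fix x y f assume xy: "x \<in> L" "y \<in> L" and eq: "signed_pullback s p E x = signed_pullback s p E y"
  show "x f = y f"
  proof (cases "f \<in> F")
    case True
    then obtain e where "e \<in> E" "f = p e" using p by blast
    then show ?thesis
      using fun_cong[OF eq, of e] s[of e] by (auto simp: signed_pullback_def)
  next
    case False
    then show ?thesis
      using halving_lattice.outside[OF L xy(1)] halving_lattice.outside[OF L xy(2)] by simp
  qed
qed

section \<open>Uniqueness up to signs\<close>

text \<open>
  Rows \<open>p 0, ..., p n\<close> are linked by columns \<open>j 0, ..., j (n - 1)\<close> to a path without chords in the support
  of \<open>r\<close>, and the signed sum of the rows vanishes in these columns. If it had the entry \<open>\<plusminus>2\<close> in a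
  column \<open>e\<close> closing the path to a chordless cycle, this cycle would be a submatrix of determinant \<open>\<plusminus>2\<close>.
  Halving excludes the entry \<open>\<plusminus>2\<close> directly: since adjacent rows cancel in the columns \<open>j k\<close>, half of the
  sum would have to contain either all of the signed rows or none of them.
\<close>

lemma (in fundamental_vectors) chordless_cycle:
  fixes p :: "nat \<Rightarrow> 'a"
  assumes inj: "inj_on p {..n}" and pT: "p ` {..n} \<subseteq> T"
    and unit: "\<And>k. k \<le> n \<Longrightarrow> \<bar>s k\<bar> = (1::int)"
    and chordless: "\<And>i k. i \<le> n \<Longrightarrow> k < n \<Longrightarrow> i \<noteq> k \<Longrightarrow> i \<noteq> Suc k \<Longrightarrow> r (p i) (j k) = 0"
    and edge: "\<And>k. k < n \<Longrightarrow> r (p k) (j k) \<noteq> 0"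
    and cancel: "\<And>k. k < n \<Longrightarrow> s k * r (p k) (j k) + s (Suc k) * r (p (Suc k)) (j k) = 0"
  shows "\<bar>\<Sum>k\<le>n. s k * r (p k) e\<bar> \<noteq> 2"
proof
  assume two: "\<bar>\<Sum>k\<le>n. s k * r (p k) e\<bar> = 2"
  define z where "z = (\<lambda>f. \<Sum>k\<le>n. s k * r (p k) f)"
  have pT': "p k \<in> T" if "k \<le> n" for k
    using pT that by auto
  have zL: "z \<in> L"
    unfolding z_def by (intro combination r_mem pT') auto
  have collapse: "(\<Sum>k\<le>n. a k * r (p k) (j m)) =
      a m * r (p m) (j m) + a (Suc m) * r (p (Suc m)) (j m)" if m: "m < n" for a m
  proof -
    have "(\<Sum>k\<le>n. a k * r (p k) (j m)) = (\<Sum>k\<in>{m, Suc m}. a k * r (p k) (j m))"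
      using m chordless by (intro sum.mono_neutral_right) auto
    then show ?thesis by simp
  qed
  have z_path: "z (p k) = s k" if k: "k \<le> n" for k
  proof -
    have "z (p k) = (\<Sum>i\<le>n. if i = k then s i else 0)"
      unfolding z_def
    proof (intro sum.cong refl)
      fix i assume "i \<in> {..n}"
      then show "s i * r (p i) (p k) = (if i = k then s i else 0)"
        using inj k r_unit[OF pT' pT', of i k] by (auto simp: inj_on_def)
    qed
    then show ?thesis using k by simp
  qed
  have z_off: "z t = 0" if "t \<in> T" "t \<notin> p ` {..n}" for t
    unfolding z_def using that by (intro sum.neutral) (auto simp: r_unit pT')
  obtain y where y: "y \<in> L" "\<And>f. \<bar>z f - 2 * y f\<bar> \<le> 1"
    using halve[OF zL] by blast
  have y_off: "y t = 0" if "t \<in> T" "t \<notin> p ` {..n}" for t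
    using y(2)[of t] z_off[OF that] by linarith
  have y_exp: "y f = (\<Sum>k\<le>n. y (p k) * r (p k) f)" for f
  proof -
    have "y f = (\<Sum>t\<in>T. y t * r t f)"
      by (rule expansion[OF y(1)])
    also have "\<dots> = (\<Sum>t\<in>p ` {..n}. y t * r t f)"
      using pT y_off by (intro sum.mono_neutral_right finite_T) auto
    also have "\<dots> = (\<Sum>k\<le>n. y (p k) * r (p k) f)"
      by (simp add: sum.reindex[OF inj])
    finally show ?thesis .
  qed
  \<comment> \<open>The multiplicity, 0 or 1, of the signed row \<open>s k * r (p k)\<close> in \<open>y\<close>.\<close>
  define h where "h k = y (p k) * s k" for k
  have y_h: "y (p k) = h k * s k" if "k \<le> n" for k
    using unit[OF that] by (auto simp: h_def abs_if split: if_splits)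
  have step: "h (Suc m) = h m" if m: "m < n" for m
  proof -
    have "z (j m) = 0"
      unfolding z_def using collapse[OF m, of s] cancel[OF m] by simp
    then have "y (j m) = 0"
      using y(2)[of "j m"] by linarith
    then have "0 = y (p m) * r (p m) (j m) + y (p (Suc m)) * r (p (Suc m)) (j m)"
      using y_exp[of "j m"] collapse[OF m, of "\<lambda>k. y (p k)"] by simp
    also have "\<dots> = h m * (s m * r (p m) (j m)) + h (Suc m) * (s (Suc m) * r (p (Suc m)) (j m))"
      using y_h m by simp
    also have "s (Suc m) * r (p (Suc m)) (j m) = - (s m * r (p m) (j m))"
      using cancel[OF m] by linarith
    finally have "(h m - h (Suc m)) * (s m * r (p m) (j m)) = 0"
      unfolding left_diff_distrib mult_minus_right by linarith
    moreover have "s m * r (p m) (j m) \<noteq> 0"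
      using edge[OF m] unit[of m] m by auto
    ultimately show ?thesis
      by (metis eq_iff_diff_eq_0 mult_eq_0_iff)
  qed
  have const: "h k = h 0" if "k \<le> n" for k
    using that by (induction k) (auto simp: step)
  have "y e = h 0 * z e"
    unfolding z_def sum_distrib_left y_exp[of e]
  proof (intro sum.cong refl)
    fix k assume "k \<in> {..n}"
    then show "y (p k) * r (p k) e = h 0 * (s k * r (p k) e)"
      using y_h[of k] const[of k] by (simp only: atMost_iff mult.assoc)
  qed
  then have "\<bar>(1 - 2 * h 0) * z e\<bar> \<le> 1"
    using y(2)[of e] by (simp add: algebra_simps)
  then have "\<bar>1 - 2 * h 0\<bar> * 2 \<le> 1"
    using two by (simp add: abs_mult z_def)
  then show False
    by presburger
qed

text \<open>
  The signs of the new column \<open>e\<close> are compared with those of the columns \<open>J\<close> already treated. Rows on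
  which the two columns agree (\<open>P\<close>) and rows on which they are opposite (\<open>N\<close>) cannot be linked through
  \<open>J\<close>: a shortest link would close up, through \<open>e\<close>, to a chordless cycle whose signed row sum has
  entry \<open>\<plusminus>2\<close> at \<open>e\<close> for one of the two matrices. So all rows and columns linked to \<open>N\<close> may be negated.
\<close>

lemma camion_column:
  assumes F0: "fundamental_vectors E L0 T r0" and F1: "fundamental_vectors E L1 T r1"
    and agree: "\<And>i j. i \<in> T \<Longrightarrow> j \<in> J \<Longrightarrow> r0 i j = r1 i j"
    and parity: "\<And>i. i \<in> T \<Longrightarrow> even (r0 i e) \<longleftrightarrow> even (r1 i e)"
    and disj: "T \<inter> J = {}" "e \<notin> T" "e \<notin> J"
  obtains t :: "'a \<Rightarrow> int" where "\<And>a. \<bar>t a\<bar> = 1"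
    and "\<And>i j. i \<in> T \<Longrightarrow> j \<in> insert e J \<Longrightarrow> r1 i j = t i * t j * r0 i j"
proof -
  interpret F0: fundamental_vectors E L0 T r0 by fact
  interpret F1: fundamental_vectors E L1 T r1 by fact
  define P where "P = {i \<in> T. r0 i e \<noteq> 0 \<and> r1 i e = r0 i e}"
  define N where "N = {i \<in> T. r0 i e \<noteq> 0 \<and> r1 i e = - r0 i e}"
  define R where "R = {(i, i'). i \<in> T \<and> i' \<in> T \<and> (\<exists>j\<in>J. r0 i j \<noteq> 0 \<and> r0 i' j \<noteq> 0)}"
  have trit: "r i e = -1 \<or> r i e = 0 \<or> r i e = 1" if "\<bar>r i e\<bar> \<le> 1" for r :: "'a \<Rightarrow> 'a \<Rightarrow> int" and i
    using that by arith
  have PN: "i \<in> P \<or> i \<in> N \<or> r0 i e = 0 \<and> r1 i e = 0" if "i \<in> T" for i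
    using trit[of r0, OF F0.r_small[OF that, of e]] trit[of r1, OF F1.r_small[OF that, of e]] parity[OF that] that
    unfolding P_def N_def by auto
  have symR: "(a, b) \<in> R \<Longrightarrow> (b, a) \<in> R" for a b
    unfolding R_def by blast
  have no_path: "(x, y) \<notin> R\<^sup>*" if "x \<in> P" "y \<in> N" for x y
  proof
    assume "(x, y) \<in> R\<^sup>*"
    then have ex: "\<exists>n x y. x \<in> P \<and> y \<in> N \<and> (x, y) \<in> R ^^ n"
      using that rtrancl_imp_relpow by blast
    define n where "n = (LEAST n. \<exists>x y. x \<in> P \<and> y \<in> N \<and> (x, y) \<in> R ^^ n)"
    obtain x y where xy: "x \<in> P" "y \<in> N" "(x, y) \<in> R ^^ n"
      using LeastI_ex[OF ex] unfolding n_def by blast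
    have minimal: "n \<le> m" if "x' \<in> P" "y' \<in> N" "(x', y') \<in> R ^^ m" for x' y' m
      unfolding n_def using that by (intro Least_le) blast
    obtain p where p: "p 0 = x" "p n = y" "\<And>k. k < n \<Longrightarrow> (p k, p (Suc k)) \<in> R"
      using xy(3) unfolding relpow_fun_conv by blast
    have seg: "(p a, p b) \<in> R ^^ (b - a)" if "a \<le> b" "b \<le> n" for a b
      unfolding relpow_fun_conv using that p(3) by (intro exI[of _ "\<lambda>k. p (a + k)"]) auto
    have "n \<noteq> 0"
      using p(1,2) xy(1,2) unfolding P_def N_def by (cases "n = 0") auto
    have pT: "p k \<in> T" if "k \<le> n" for k
    proof (cases "k = n")
      case True
      then show ?thesis using p(2) xy(2) by (simp add: N_def)
    next
      case False
      then show ?thesis using p(3)[of k] that by (simp add: R_def)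
    qed
    \<comment> \<open>By minimality the path has no chords, repeats no row, and meets \<open>P\<close> and \<open>N\<close> only at its ends.\<close>
    have shortcut: "b \<le> Suc a" if ab: "a < b" "b \<le> n" "(p a, p b) \<in> R" for a b
    proof -
      have "(p 0, p a) \<in> R ^^ a" "(p b, p n) \<in> R ^^ (n - b)"
        using seg[of 0 a] seg[of b n] ab by auto
      then have "(p 0, p n) \<in> R ^^ a O R O R ^^ (n - b)"
        using ab(3) by blast
      also have "R ^^ a O R O R ^^ (n - b) = R ^^ (Suc a + (n - b))"
        by (simp only: relpow_add relpow.simps(2) O_assoc)
      finally have "n \<le> Suc a + (n - b)"
        using minimal[of x y] xy p(1,2) by simp
      then show ?thesis using ab(1,2) by linarith
    qed
    have neq: "p a \<noteq> p b" if ab: "a < b" "b \<le> n" for a b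
    proof
      assume eq: "p a = p b"
      have "(p 0, p a) \<in> R ^^ a" "(p a, p n) \<in> R ^^ (n - b)"
        using seg[of 0 a] seg[of b n] ab eq by auto
      then have "(p 0, p n) \<in> R ^^ (a + (n - b))"
        unfolding relpow_add by blast
      then have "n \<le> a + (n - b)"
        using minimal[of x y] xy p(1,2) by simp
      then show False using ab by linarith
    qed
    have inj: "inj_on p {..n}"
      using neq by (intro linorder_inj_onI) auto
    have interior: "r0 (p k) e = 0 \<and> r1 (p k) e = 0" if k: "0 < k" "k < n" for k
    proof -
      have "p k \<notin> P"
        using minimal[of "p k" y "n - k"] seg[of k n] xy(2) p(2) k by auto
      moreover have "p k \<notin> N"
        using minimal[of x "p k" k] seg[of 0 k] xy(1) p(1) k by auto
      ultimately show ?thesis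
        using PN[OF pT[of k]] k by auto
    qed
    have "\<forall>k\<in>{..<n}. \<exists>j. j \<in> J \<and> r0 (p k) j \<noteq> 0 \<and> r0 (p (Suc k)) j \<noteq> 0"
      using p(3) unfolding R_def by auto
    from bchoice[OF this] obtain j where
      j: "\<And>k. k < n \<Longrightarrow> j k \<in> J" "\<And>k. k < n \<Longrightarrow> r0 (p k) (j k) \<noteq> 0"
        "\<And>k. k < n \<Longrightarrow> r0 (p (Suc k)) (j k) \<noteq> 0"
      by auto
    have chordless: "r0 (p i) (j k) = 0" if ik: "i \<le> n" "k < n" "i \<noteq> k" "i \<noteq> Suc k" for i k
    proof (rule ccontr)
      assume nz: "r0 (p i) (j k) \<noteq> 0"
      show False
      proof (cases "i < k")
        case True
        have "(p i, p (Suc k)) \<in> R"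
          using nz j[OF ik(2)] pT ik unfolding R_def by auto
        then show False
          using shortcut[of i "Suc k"] True ik by auto
      next
        case False
        have "(p k, p i) \<in> R"
          using nz j[OF ik(2)] pT ik unfolding R_def by auto
        then show False
          using shortcut[of k i] False ik by auto
      qed
    qed
    \<comment> \<open>Signs that cancel consecutive rows in the column linking them.\<close>
    define s where "s = rec_nat (1::int) (\<lambda>k a. - a * r0 (p k) (j k) * r0 (p (Suc k)) (j k))"
    have s0: "s 0 = 1" and sS: "s (Suc k) = - s k * r0 (p k) (j k) * r0 (p (Suc k)) (j k)" for k
      by (simp_all add: s_def)
    have one: "\<bar>r0 (p k) (j k)\<bar> = 1" "\<bar>r0 (p (Suc k)) (j k)\<bar> = 1" if "k < n" for k
      using j(2,3)[OF that] F0.r_small[OF pT, of k "j k"] F0.r_small[OF pT, of "Suc k" "j k"] that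
      by linarith+
    have unit: "\<bar>s k\<bar> = 1" if "k \<le> n" for k
      using that by (induction k) (auto simp: s0 sS abs_mult one)
    have cancel: "s k * r0 (p k) (j k) + s (Suc k) * r0 (p (Suc k)) (j k) = 0" if "k < n" for k
    proof -
      have "r0 (p (Suc k)) (j k) * r0 (p (Suc k)) (j k) = 1"
        using one(2)[OF that] by (metis abs_mult_self_eq mult_1)
      then show ?thesis
        by (simp add: sS algebra_simps)
    qed
    have agree': "r1 (p i) (j k) = r0 (p i) (j k)" if "i \<le> n" "k < n" for i k
      using agree[OF pT j(1)] that by simp
    have ends: "(\<Sum>k\<le>n. s k * r (p k) e) = r x e + s n * r y e"
      if "\<And>k. 0 < k \<Longrightarrow> k < n \<Longrightarrow> r (p k) e = 0" for r :: "'a \<Rightarrow> 'a \<Rightarrow> int"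
    proof -
      have "(\<Sum>k\<le>n. s k * r (p k) e) = (\<Sum>k\<in>{0, n}. s k * r (p k) e)"
        using that by (intro sum.mono_neutral_right) auto
      then show ?thesis
        using \<open>n \<noteq> 0\<close> by (simp add: s0 p)
    qed
    have "\<bar>r0 x e + s n * r0 y e\<bar> \<noteq> 2"
      using F0.chordless_cycle[OF inj _ unit chordless j(2) cancel, of e] pT ends[of r0] interior
      by auto
    moreover have "\<bar>r1 x e + s n * r1 y e\<bar> \<noteq> 2"
    proof -
      have "p ` {..n} \<subseteq> T"
        using pT by auto
      then have "\<bar>\<Sum>k\<le>n. s k * r1 (p k) e\<bar> \<noteq> 2"
        by (rule F1.chordless_cycle[OF inj _ unit, where j = j])
          (use chordless j(2) cancel in \<open>auto simp: agree'\<close>)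
      then show ?thesis
        using ends[of r1] interior by simp
    qed
    moreover have "r1 x e = r0 x e" "r1 y e = - r0 y e" "\<bar>r0 x e\<bar> = 1" "\<bar>r0 y e\<bar> = 1"
      using xy(1,2) F0.r_small[of x e] F0.r_small[of y e] unfolding P_def N_def by auto
    ultimately show False
      using unit[of n] by (auto simp: abs_if split: if_splits)
  qed
  \<comment> \<open>Negating the component \<open>C\<close> of \<open>N\<close>, with the columns \<open>D\<close> that it meets, changes no entry in \<open>J\<close>.\<close>
  define C where "C = R\<^sup>* `` N"
  have C_R: "a \<in> C \<Longrightarrow> (a, b) \<in> R \<Longrightarrow> b \<in> C" for a b
    unfolding C_def by (meson Image_iff rtrancl.rtrancl_into_rtrancl)
  have NC: "N \<subseteq> C"
    unfolding C_def by blast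
  have "sym R"
    using symR by (auto intro: symI)
  then have "sym (R\<^sup>*)"
    by (rule sym_rtrancl)
  then have PC: "P \<inter> C = {}"
    unfolding C_def using no_path by (auto dest: symD)
  define D where "D = {j \<in> J. \<exists>i\<in>T \<inter> C. r0 i j \<noteq> 0}"
  define t :: "'a \<Rightarrow> int" where "t a = (if a \<in> T \<inter> C \<or> a \<in> D then -1 else 1)" for a
  show thesis
  proof (rule that[of t])
    show "\<bar>t a\<bar> = 1" for a
      by (simp add: t_def)
    fix i j assume i: "i \<in> T" and j: "j \<in> insert e J"
    have ti: "t i = (if i \<in> C then -1 else 1)"
      using i disj by (auto simp: t_def D_def)
    show "r1 i j = t i * t j * r0 i j"
    proof (cases "j = e")
      case True
      have "t e = 1"
        using disj by (auto simp: t_def D_def)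
      then show ?thesis
        using PN[OF i] NC PC True ti by (auto simp: P_def N_def)
    next
      case False
      then have jJ: "j \<in> J" using j by blast
      have tj: "t j = (if j \<in> D then -1 else 1)"
        using jJ disj by (auto simp: t_def)
      have "i \<in> C \<longleftrightarrow> j \<in> D" if "r0 i j \<noteq> 0"
        using that i jJ C_R unfolding D_def R_def by blast
      then have "t i * t j * r0 i j = r0 i j"
        using ti tj by auto
      then show ?thesis
        using agree[OF i jJ] by simp
    qed
  qed
qed

lemma fundamental_vectors_resign:
  assumes "fundamental_vectors E L T r" and s: "\<And>a. \<bar>s a\<bar> = 1"
  shows "fundamental_vectors E (signed_pullback s id E ` L) T (\<lambda>i e. s i * s e * r i e)"
proof -
  interpret fundamental_vectors E L T r by fact
  interpret S: halving_lattice E "signed_pullback s id E ` L"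
    by (rule halving_lattice_signed_pullback[OF halving_lattice_axioms finite_E s])
  have sh: "shattered (signed_pullback s id E ` L) I \<longleftrightarrow> shattered L I" if "I \<subseteq> E" for I
    using shattered_signed_pullback[OF halving_lattice_axioms finite_E s that, of id] by simp
  show ?thesis
  proof
    show "T \<subseteq> E" by (rule T_sub)
    show "shattered (signed_pullback s id E ` L) T"
      using T_shattered by (simp add: sh[OF T_sub])
    show "\<not> shattered (signed_pullback s id E ` L) (insert a T)" if "a \<in> E - T" for a
      using T_maximal[OF that] that T_sub by (simp add: sh)
    fix i assume i: "i \<in> T"
    have "(\<lambda>e. s i * s e * r i e) = signed_pullback s id E (\<lambda>e. s i * r i e)"
      using outside[OF r_mem[OF i]] by (auto simp: signed_pullback_def)
    then show "(\<lambda>e. s i * s e * r i e) \<in> signed_pullback s id E ` L"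
      using scale[OF r_mem[OF i], of "s i"] by simp
    show "s i * s f * r i f = of_bool (f = i)" if "f \<in> T" for f
      using r_unit[OF i that] s[of i] by (auto simp: unit_square)
    show "\<bar>s i * s f * r i f\<bar> \<le> 1" for f
      using r_small[OF i, of f] s by (simp add: abs_mult)
  qed
qed

lemma camion_signing:
  assumes F0: "fundamental_vectors E L0 T r0" and F1: "fundamental_vectors E L1 T r1"
    and parity: "\<And>i j. i \<in> T \<Longrightarrow> even (r0 i j) \<longleftrightarrow> even (r1 i j)"
    and J: "finite J" "T \<inter> J = {}"
  shows "\<exists>s :: 'a \<Rightarrow> int. (\<forall>a. \<bar>s a\<bar> = 1) \<and> (\<forall>i\<in>T. \<forall>j\<in>J. r1 i j = s i * s j * r0 i j)"
  using J
proof (induction J)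
  case empty
  show ?case by (intro exI[of _ "\<lambda>_. 1"]) auto
next
  case (insert e J)
  then obtain s where s: "\<And>a. \<bar>s a\<bar> = 1"
    and "\<forall>i\<in>T. \<forall>j\<in>J. r1 i j = s i * s j * r0 i j"
    by auto
  then have sr: "s i * s j * r0 i j = r1 i j" if "i \<in> T" "j \<in> J" for i j
    using that by simp
  have odd: "odd (s a)" for a
    by (rule unit_odd[OF s])
  have par: "even (s i * s e * r0 i e) \<longleftrightarrow> even (r1 i e)" if "i \<in> T" for i
    using odd parity[OF that] by simp
  obtain t where t: "\<And>a. \<bar>t a\<bar> = 1"
    "\<And>i j. i \<in> T \<Longrightarrow> j \<in> insert e J \<Longrightarrow> r1 i j = t i * t j * (s i * s j * r0 i j)"
    using camion_column[OF fundamental_vectors_resign[OF F0, of s] F1 sr par] s insert by auto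
  show ?case
    using t s by (intro exI[of _ "\<lambda>a. t a * s a"]) (auto simp: abs_mult ac_simps)
qed

text \<open>
  The two standard forms with respect to a common basis have entries in \<open>{-1, 0, 1}\<close> and agree modulo
  2, so they differ at most by signs, which \<open>camion_signing\<close> absorbs into rows and columns. This is
  the unique representability of regular matroids, with Camion's argument for the signs.
\<close>

lemma lattice_determined_up_to_signs:
  assumes L0: "halving_lattice E L0" and L1: "halving_lattice E L1"
    and same: "\<And>I. I \<subseteq> E \<Longrightarrow> shattered L0 I \<longleftrightarrow> shattered L1 I"
  shows "\<exists>s :: 'e \<Rightarrow> int. (\<forall>a. \<bar>s a\<bar> = 1) \<and> L1 = signed_pullback s id E ` L0"
proof -
  interpret L0: halving_lattice E L0 by fact
  interpret L1: halving_lattice E L1 by fact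
  obtain T where T: "T \<subseteq> E" "shattered L0 T" "\<And>a. a \<in> E - T \<Longrightarrow> \<not> shattered L0 (insert a T)"
    using L0.maximal_shattered[OF L0.finite_E] by blast
  have T1: "shattered L1 T" "\<And>a. a \<in> E - T \<Longrightarrow> \<not> shattered L1 (insert a T)"
    using T same by auto
  have "\<forall>k\<in>T. \<exists>z. z \<in> L0 \<and> (\<forall>f\<in>T. z f = of_bool (f = k)) \<and> (\<forall>f. \<bar>z f\<bar> \<le> 1)"
    using L0.shattered_unit[OF T(2)] by blast
  from bchoice[OF this] obtain r0 where r0: "\<forall>k\<in>T. r0 k \<in> L0 \<and>
      (\<forall>f\<in>T. r0 k f = of_bool (f = k)) \<and> (\<forall>f. \<bar>r0 k f\<bar> \<le> 1)" by blast
  have "\<forall>k\<in>T. \<exists>z. z \<in> L1 \<and> (\<forall>f\<in>T. z f = of_bool (f = k)) \<and> (\<forall>f. \<bar>z f\<bar> \<le> 1)"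
    using L1.shattered_unit[OF T1(1)] by blast
  from bchoice[OF this] obtain r1 where r1: "\<forall>k\<in>T. r1 k \<in> L1 \<and>
      (\<forall>f\<in>T. r1 k f = of_bool (f = k)) \<and> (\<forall>f. \<bar>r1 k f\<bar> \<le> 1)" by blast
  interpret F0: fundamental_vectors E L0 T r0
    by unfold_locales (use T r0 in auto)
  interpret F1: fundamental_vectors E L1 T r1
    by unfold_locales (use T T1 r1 in auto)
  have parity: "even (r0 i j) \<longleftrightarrow> even (r1 i j)" if i: "i \<in> T" for i j
  proof -
    consider "j \<in> T" | "j \<notin> E" | "j \<in> E - T" by blast
    then show ?thesis
    proof cases
      case 1
      then show ?thesis using i by (simp add: F0.r_unit F1.r_unit)
    next
      case 2
      then show ?thesis
        using L0.outside[OF F0.r_mem[OF i]] L1.outside[OF F1.r_mem[OF i]] by simp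
    next
      case 3
      then have "insert j (T - {i}) \<subseteq> E" using T(1) by blast
      then show ?thesis
        using F0.odd_entry_iff_exchange[OF i 3] F1.odd_entry_iff_exchange[OF i 3] same by blast
    qed
  qed
  obtain s where s: "\<And>a. \<bar>s a\<bar> = 1"
    and sr: "\<forall>i\<in>T. \<forall>j\<in>E - T. r1 i j = s i * s j * r0 i j"
    using camion_signing[OF F0.fundamental_vectors_axioms F1.fundamental_vectors_axioms parity, of "E - T"]
      L0.finite_E by auto
  have row: "r1 i j = s i * (s j * r0 i j)" if i: "i \<in> T" for i j
  proof -
    consider "j \<in> T" | "j \<notin> E" | "j \<in> E - T" by blast
    then show ?thesis
    proof cases
      case 1
      then show ?thesis using i s[of i] by (auto simp: F0.r_unit F1.r_unit unit_square)
    next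
      case 2
      then show ?thesis
        using L0.outside[OF F0.r_mem[OF i]] L1.outside[OF F1.r_mem[OF i]] by simp
    next
      case 3
      then show ?thesis using sr i by (simp add: mult.assoc)
    qed
  qed
  have "L1 = signed_pullback s id E ` L0"
  proof
    show "L1 \<subseteq> signed_pullback s id E ` L0"
    proof
      fix z assume z: "z \<in> L1"
      let ?x = "\<lambda>e. \<Sum>i\<in>T. (z i * s i) * r0 i e"
      have "?x \<in> L0"
        by (intro L0.combination F0.finite_T F0.r_mem)
      moreover have "z = signed_pullback s id E ?x"
      proof
        fix e
        show "z e = signed_pullback s id E ?x e"
        proof (cases "e \<in> E")
          case True
          then have "signed_pullback s id E ?x e = (\<Sum>i\<in>T. z i * r1 i e)"
            unfolding signed_pullback_def id_apply if_P[OF True] sum_distrib_left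
            by (intro sum.cong refl) (simp add: row ac_simps)
          then show ?thesis
            using F1.expansion[OF z, of e] by simp
        qed (simp add: L1.outside[OF z] signed_pullback_def)
      qed
      ultimately show "z \<in> signed_pullback s id E ` L0"
        by (intro image_eqI[where x = ?x])
    qed
    show "signed_pullback s id E ` L0 \<subseteq> L1"
    proof
      fix z assume "z \<in> signed_pullback s id E ` L0"
      then obtain x where x: "z = signed_pullback s id E x" "x \<in> L0"
        by (rule imageE)
      have "z = (\<lambda>e. \<Sum>i\<in>T. (x i * s i) * r1 i e)"
      proof
        fix e
        have "(\<Sum>i\<in>T. (x i * s i) * r1 i e) = (\<Sum>i\<in>T. s e * (x i * r0 i e))"
        proof (intro sum.cong refl)
          fix i assume "i \<in> T"
          then have "(x i * s i) * r1 i e = (s i * s i) * (s e * (x i * r0 i e))"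
            by (simp add: row ac_simps)
          then show "(x i * s i) * r1 i e = s e * (x i * r0 i e)"
            by (simp only: unit_square[OF s] mult_1)
        qed
        also have "\<dots> = s e * x e"
          using F0.expansion[OF x(2), of e] by (simp add: sum_distrib_left)
        also have "\<dots> = z e"
          using L0.outside[OF x(2)] by (simp add: x(1) signed_pullback_def)
        finally show "z e = (\<Sum>i\<in>T. (x i * s i) * r1 i e)" ..
      qed
      also have "\<dots> \<in> L1"
        by (intro L1.combination F0.finite_T F1.r_mem)
      finally show "z \<in> L1" .
    qed
  qed
  then show ?thesis
    by (intro exI[of _ s] conjI allI s)
qed

section \<open>Bases and linear independence\<close>

definition lattice_basis :: "('e \<Rightarrow> int) set \<Rightarrow> 'i set \<Rightarrow> ('i \<Rightarrow> 'e \<Rightarrow> int) \<Rightarrow> bool" where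
  "lattice_basis L J B \<longleftrightarrow> finite J \<and> (\<forall>j\<in>J. B j \<in> L) \<and>
     (\<forall>z\<in>L. \<exists>!c. (\<forall>j. j \<notin> J \<longrightarrow> c j = 0) \<and> z = (\<lambda>e. \<Sum>j\<in>J. c j * B j e))"

lemma lattice_basis_mem: "lattice_basis L J B \<Longrightarrow> j \<in> J \<Longrightarrow> B j \<in> L"
  by (simp add: lattice_basis_def)

lemma lattice_basis_span:
  assumes "lattice_basis L J B" "z \<in> L"
  shows "\<exists>c. z = (\<lambda>e. \<Sum>j\<in>J. c j * B j e)"
  using assms unfolding lattice_basis_def by metis

lemma lattice_basis_unique:
  assumes B: "lattice_basis L J B" and z: "z \<in> L"
    and c: "\<And>j. j \<notin> J \<Longrightarrow> c j = 0" "z = (\<lambda>e. \<Sum>j\<in>J. c j * B j e)"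
    and d: "\<And>j. j \<notin> J \<Longrightarrow> d j = 0" "z = (\<lambda>e. \<Sum>j\<in>J. d j * B j e)"
  shows "c = d"
proof -
  have "\<exists>!c. (\<forall>j. j \<notin> J \<longrightarrow> c j = 0) \<and> z = (\<lambda>e. \<Sum>j\<in>J. c j * B j e)"
    using B z unfolding lattice_basis_def by (elim conjE bspec)
  note the = the1_equality[OF this]
  have "(\<forall>j. j \<notin> J \<longrightarrow> c j = 0) \<and> z = (\<lambda>e. \<Sum>j\<in>J. c j * B j e)"
    "(\<forall>j. j \<notin> J \<longrightarrow> d j = 0) \<and> z = (\<lambda>e. \<Sum>j\<in>J. d j * B j e)"
    using c d by simp_all
  then show ?thesis
    by (rule trans[OF the[symmetric] the])
qed

lemma lattice_basis_map:
  assumes B: "lattice_basis L J B" and L: "\<And>c. (\<lambda>e. \<Sum>j\<in>J. c j * B j e) \<in> L"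
    and inj: "inj_on f L"
    and linear: "\<And>c. f (\<lambda>e. \<Sum>j\<in>J. c j * B j e) = (\<lambda>e. \<Sum>j\<in>J. c j * f (B j) e)"
  shows "lattice_basis (f ` L) J (\<lambda>j. f (B j))"
  unfolding lattice_basis_def
proof (intro conjI ballI)
  show "finite J"
    using B by (simp add: lattice_basis_def)
  show "f (B j) \<in> f ` L" if "j \<in> J" for j
    using lattice_basis_mem[OF B that] by (rule imageI)
  fix y assume "y \<in> f ` L"
  then obtain z where z: "y = f z" "z \<in> L"
    by (rule imageE)
  have key: "y = (\<lambda>e. \<Sum>j\<in>J. c j * f (B j) e) \<longleftrightarrow> z = (\<lambda>e. \<Sum>j\<in>J. c j * B j e)" for c
    unfolding linear[symmetric] z(1) by (rule inj_on_eq_iff[OF inj z(2) L])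
  show "\<exists>!c. (\<forall>j. j \<notin> J \<longrightarrow> c j = 0) \<and> y = (\<lambda>e. \<Sum>j\<in>J. c j * f (B j) e)"
    using B z(2) unfolding key lattice_basis_def by (elim conjE bspec)
qed

lemma lattice_basis_reindex:
  assumes B: "lattice_basis L J B" and h: "bij_betw h J' J"
  shows "lattice_basis L J' (\<lambda>j. B (h j))"
  unfolding lattice_basis_def
proof (intro conjI ballI)
  show "finite J'"
    using B bij_betw_finite[OF h] by (simp add: lattice_basis_def)
  show "B (h j) \<in> L" if "j \<in> J'" for j
    using that bij_betwE[OF h] by (intro lattice_basis_mem[OF B]) blast
  fix z assume z: "z \<in> L"
  define push where "push c i = (if i \<in> J then c (inv_into J' h i) else (0 :: int))" for c i
  have inv: "inv_into J' h (h j) = j" if "j \<in> J'" for j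
    using h that by (simp add: bij_betw_inv_into_left)
  have push: "(\<Sum>j\<in>J'. c j * B (h j) e) = (\<Sum>i\<in>J. push c i * B i e)" for c e
  proof -
    have "(\<Sum>j\<in>J'. c j * B (h j) e) = (\<Sum>j\<in>J'. push c (h j) * B (h j) e)"
      using bij_betwE[OF h] by (intro sum.cong refl) (simp add: push_def inv)
    then show ?thesis
      using sum.reindex_bij_betw[OF h, of "\<lambda>i. push c i * B i e"] by simp
  qed
  show "\<exists>!c. (\<forall>j. j \<notin> J' \<longrightarrow> c j = 0) \<and> z = (\<lambda>e. \<Sum>j\<in>J'. c j * B (h j) e)"
  proof (rule ex_ex1I)
    from lattice_basis_span[OF B z] obtain c where c: "z = (\<lambda>e. \<Sum>j\<in>J. c j * B j e)" ..
    have "z = (\<lambda>e. \<Sum>j\<in>J'. (if j \<in> J' then c (h j) else 0) * B (h j) e)"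
    proof
      fix e
      show "z e = (\<Sum>j\<in>J'. (if j \<in> J' then c (h j) else 0) * B (h j) e)"
        using sum.reindex_bij_betw[OF h, of "\<lambda>i. c i * B i e"] by (simp add: c)
    qed
    then show "\<exists>c. (\<forall>j. j \<notin> J' \<longrightarrow> c j = 0) \<and> z = (\<lambda>e. \<Sum>j\<in>J'. c j * B (h j) e)"
      by (intro exI[of _ "\<lambda>j. if j \<in> J' then c (h j) else 0"] conjI) simp_all
  next
    fix c d
    assume c: "(\<forall>j. j \<notin> J' \<longrightarrow> c j = 0) \<and> z = (\<lambda>e. \<Sum>j\<in>J'. c j * B (h j) e)"
      and d: "(\<forall>j. j \<notin> J' \<longrightarrow> d j = 0) \<and> z = (\<lambda>e. \<Sum>j\<in>J'. d j * B (h j) e)"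
    have eq: "push c = push d"
    proof (rule lattice_basis_unique[OF B z])
      show "z = (\<lambda>e. \<Sum>i\<in>J. push c i * B i e)"
        using conjunct2[OF c] unfolding push .
      show "z = (\<lambda>e. \<Sum>i\<in>J. push d i * B i e)"
        using conjunct2[OF d] unfolding push .
    qed (simp_all add: push_def)
    show "c = d"
    proof
      fix j
      show "c j = d j"
      proof (cases "j \<in> J'")
        case True
        then have "h j \<in> J"
          using bij_betwE[OF h] by blast
        then show ?thesis
          using fun_cong[OF eq, of "h j"] inv[OF True] by (simp add: push_def)
      next
        case False
        then show ?thesis using c d by simp
      qed
    qed
  qed
qed

context halving_lattice
begin

text \<open>
  The condition on the right does not mention the field. With \<open>'k = real\<close> it describes the cographic
  matroid of a graph, with \<open>'k = bit\<close> the matroid of the columns modulo 2; so the two agree.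
\<close>

lemma independent_columns_iff_shattered:
  fixes B :: "'i \<Rightarrow> 'e \<Rightarrow> int"
  assumes B: "lattice_basis L J B" and "finite I"
  shows "(\<forall>c :: 'e \<Rightarrow> 'k::field. (\<forall>j\<in>J. (\<Sum>e\<in>I. c e * of_int (B j e)) = 0) \<longrightarrow> (\<forall>e\<in>I. c e = 0))
    \<longleftrightarrow> shattered L I"
proof
  assume I: "shattered L I"
  show "\<forall>c :: 'e \<Rightarrow> 'k. (\<forall>j\<in>J. (\<Sum>e\<in>I. c e * of_int (B j e)) = 0) \<longrightarrow> (\<forall>e\<in>I. c e = 0)"
  proof (intro allI impI ballI)
    fix c :: "'e \<Rightarrow> 'k" and a
    assume c: "\<forall>j\<in>J. (\<Sum>e\<in>I. c e * of_int (B j e)) = 0" and a: "a \<in> I"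
    obtain z where z: "z \<in> L" "\<forall>f\<in>I. z f = of_bool (f = a)"
      using I a unfolding shattered_def by blast
    from lattice_basis_span[OF B z(1)] obtain d where d: "z = (\<lambda>e. (\<Sum>j\<in>J. d j * B j e))" by (elim exE)
    have "c a = (\<Sum>e\<in>I. if e = a then c e else 0)"
      using a assms(2) by simp
    also have "\<dots> = (\<Sum>e\<in>I. c e * of_int (z e))"
      using z(2) by (intro sum.cong refl) auto
    also have "\<dots> = (\<Sum>e\<in>I. \<Sum>j\<in>J. of_int (d j) * (c e * of_int (B j e)))"
      unfolding d of_int_sum of_int_mult sum_distrib_left
      by (intro sum.cong refl) (simp only: mult.left_commute)
    also have "\<dots> = (\<Sum>j\<in>J. of_int (d j) * (\<Sum>e\<in>I. c e * of_int (B j e)))"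
      unfolding sum_distrib_left by (rule sum.swap)
    also have "\<dots> = 0"
      by (rule sum.neutral) (use c in simp)
    finally show "c a = 0" .
  qed
next
  assume indep: "\<forall>c :: 'e \<Rightarrow> 'k. (\<forall>j\<in>J. (\<Sum>e\<in>I. c e * of_int (B j e)) = 0) \<longrightarrow> (\<forall>e\<in>I. c e = 0)"
  show "shattered L I"
  proof (rule ccontr)
    assume "\<not> shattered L I"
    from dependent_relation[OF assms(2) this] obtain a c where a: "a \<in> I"
      and rel: "\<forall>z\<in>L. z a = (\<Sum>k\<in>I - {a}. c k * z k)" by (elim exE conjE)
    define d :: "'e \<Rightarrow> 'k" where "d e = (if e = a then - 1 else of_int (c e))" for e
    have "(\<Sum>e\<in>I. d e * of_int (B j e)) = 0" if "j \<in> J" for j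
    proof -
      have "B j \<in> L"
        by (rule lattice_basis_mem[OF B that])
      then have "of_int (B j a) = (\<Sum>k\<in>I - {a}. of_int (c k) * of_int (B j k) :: 'k)"
        using bspec[OF rel, of "B j"] by simp
      also have "\<dots> = (\<Sum>k\<in>I - {a}. d k * of_int (B j k))"
        by (intro sum.cong refl) (simp add: d_def)
      finally show ?thesis
        using sum.remove[OF assms(2) a, of "\<lambda>e. d e * of_int (B j e)"] by (simp add: d_def)
    qed
    then have "d a = 0"
      using indep[rule_format, of d a] a by simp
    then show False
      by (simp add: d_def)
  qed
qed

text \<open>
  \<open>L\<close> is saturated, as \<open>y\<close> is the only function that halves \<open>2 * y\<close> up to an error of 1.
\<close>

lemma half_mem:
  assumes "(\<lambda>e. 2 * y e) \<in> L"
  shows "y \<in> L"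
proof -
  obtain y' where y': "y' \<in> L" "\<forall>e. \<bar>2 * y e - 2 * y' e\<bar> \<le> 1"
    using halve[OF assms] by blast
  have "y e = y' e" for e
    using y'(2)[rule_format, of e] by presburger
  then have "y = y'" by blast
  then show ?thesis using y'(1) by simp
qed

text \<open>
  By saturation the parity patterns are the classes of \<open>L\<close> modulo \<open>2L\<close>. In particular all bases
  have the same size.
\<close>

lemma card_parities:
  assumes B: "lattice_basis L J B"
  shows "card ((\<lambda>z. {e. odd (z e)}) ` L) = 2 ^ card J"
proof -
  have fin: "finite J" and BL: "\<And>j. j \<in> J \<Longrightarrow> B j \<in> L"
    using B unfolding lattice_basis_def by auto
  define \<phi> where "\<phi> S = {e. odd (\<Sum>j\<in>J. of_bool (j \<in> S) * B j e)}" for S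
  have inj: "inj_on \<phi> (Pow J)"
  proof (rule inj_onI)
    fix S S' assume S: "S \<in> Pow J" "S' \<in> Pow J" "\<phi> S = \<phi> S'"
    define d :: "_ \<Rightarrow> int" where "d j = of_bool (j \<in> S) - of_bool (j \<in> S')" for j
    define z where "z = (\<lambda>e. \<Sum>j\<in>J. d j * B j e)"
    have zL: "z \<in> L"
      unfolding z_def by (intro combination fin BL)
    have even: "even (z e)" for e
    proof -
      have "e \<in> \<phi> S \<longleftrightarrow> e \<in> \<phi> S'" using S(3) by simp
      then show ?thesis
        unfolding z_def d_def left_diff_distrib sum_subtractf \<phi>_def by simp
    qed
    then have "(\<lambda>e. 2 * (z e div 2)) = z"
      by (intro ext) simp
    then have "(\<lambda>e. 2 * (z e div 2)) \<in> L"
      using zL by simp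
    then have yL: "(\<lambda>e. z e div 2) \<in> L"
      by (rule half_mem)
    from lattice_basis_span[OF B yL] obtain c where c: "(\<lambda>e. z e div 2) = (\<lambda>e. \<Sum>j\<in>J. c j * B j e)" ..
    have z2: "z = (\<lambda>e. \<Sum>j\<in>J. (if j \<in> J then 2 * c j else 0) * B j e)"
    proof
      fix e
      have "z e = 2 * (z e div 2)" using even[of e] by simp
      also have "\<dots> = (\<Sum>j\<in>J. (if j \<in> J then 2 * c j else 0) * B j e)"
        unfolding fun_cong[OF c] sum_distrib_left by (intro sum.cong refl) simp
      finally show "z e = (\<Sum>j\<in>J. (if j \<in> J then 2 * c j else 0) * B j e)" .
    qed
    have "d = (\<lambda>j. if j \<in> J then 2 * c j else 0)"
      by (rule lattice_basis_unique[OF B zL _ z_def _ z2]) (use S(1,2) in \<open>auto simp: d_def\<close>)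
    then have "d j = (if j \<in> J then 2 * c j else 0)" for j
      by (rule fun_cong)
    then have "even (d j)" for j
      by (cases "j \<in> J") simp_all
    then have "even (d j)" for j .
    moreover have "(j \<in> S \<longleftrightarrow> j \<in> S') \<or> \<bar>d j\<bar> = 1" for j
      by (auto simp: d_def)
    ultimately have "j \<in> S \<longleftrightarrow> j \<in> S'" for j
      by (metis dvd_abs_iff odd_one)
    then show "S = S'"
      by blast
  qed
  have img: "\<phi> ` Pow J = (\<lambda>z. {e. odd (z e)}) ` L"
  proof
    show "\<phi> ` Pow J \<subseteq> (\<lambda>z. {e. odd (z e)}) ` L"
    proof
      fix X assume "X \<in> \<phi> ` Pow J"
      then obtain S where X: "X = \<phi> S" by blast
      have "(\<lambda>e. \<Sum>j\<in>J. of_bool (j \<in> S) * B j e) \<in> L"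
        by (intro combination fin BL)
      then show "X \<in> (\<lambda>z. {e. odd (z e)}) ` L"
        unfolding X \<phi>_def by (rule imageI)
    qed
    show "(\<lambda>z. {e. odd (z e)}) ` L \<subseteq> \<phi> ` Pow J"
    proof
      fix X assume "X \<in> (\<lambda>z. {e. odd (z e)}) ` L"
      then obtain z where z: "X = {e. odd (z e)}" "z \<in> L" by (rule imageE)
      from lattice_basis_span[OF B z(2)] obtain c where c: "z = (\<lambda>e. (\<Sum>j\<in>J. c j * B j e))" ..
      have "even (z e - (\<Sum>j\<in>J. of_bool (j \<in> {j \<in> J. odd (c j)}) * B j e))" for e
        unfolding fun_cong[OF c] sum_subtractf[symmetric] left_diff_distrib[symmetric]
      proof (intro dvd_sum)
        fix j assume "j \<in> J"
        then have "even (c j - of_bool (j \<in> {j \<in> J. odd (c j)}))"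
          by simp
        then show "even ((c j - of_bool (j \<in> {j \<in> J. odd (c j)})) * B j e)"
          by (rule dvd_mult2)
      qed
      then have "odd (z e) \<longleftrightarrow> odd (\<Sum>j\<in>J. of_bool (j \<in> {j \<in> J. odd (c j)}) * B j e)" for e
        by (simp only: even_diff even_add)
      then have "X = \<phi> {j \<in> J. odd (c j)}"
        unfolding z(1) \<phi>_def by (intro Collect_cong)
      then show "X \<in> \<phi> ` Pow J"
        by (rule image_eqI) simp
    qed
  qed
  show ?thesis
    using card_image[OF inj] unfolding img card_Pow[OF fin] .
qed

end

section \<open>The lattice of cycles of a graph\<close>

text \<open>
  A graph with all degrees even has an orientation that is balanced at every vertex. Two edges \<open>e\<close>, \<open>f\<close>
  meeting at a vertex \<open>v\<close> are merged into one edge joining their other ends, stored under the name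
  \<open>f\<close>; a balanced orientation of the smaller graph runs through \<open>v\<close> along \<open>e\<close> and \<open>f\<close>. The graph is given
  by its two maps \<open>t\<close> and \<open>h\<close>, which makes the merging a function update, and \<open>s e = -1\<close> stands for
  reversing the edge \<open>e\<close>.
\<close>

lemma balanced_signs:
  fixes t h :: "'e \<Rightarrow> 'v"
  assumes "finite S" and "\<And>v. even (\<Sum>e\<in>S. of_bool (h e = v) + of_bool (t e = v) :: int)"
  shows "\<exists>s :: 'e \<Rightarrow> int. (\<forall>e\<in>S. \<bar>s e\<bar> = 1) \<and>
           (\<forall>v. (\<Sum>e\<in>S. s e * (of_bool (h e = v) - of_bool (t e = v))) = 0)"
  using assms
proof (induction "card S" arbitrary: S t h rule: less_induct)
  case less
  note fin = less.prems(1) and even = less.prems(2)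
  show ?case
  proof (cases "\<exists>e\<in>S. h e = t e")
    case True
    then obtain e where e: "e \<in> S" "h e = t e" by blast
    have par: "even (\<Sum>e\<in>S - {e}. of_bool (h e = v) + of_bool (t e = v) :: int)" for v
      using even[of v] e(2) sum.remove[OF fin e(1), of "\<lambda>e. of_bool (h e = v) + of_bool (t e = v) :: int"]
      by simp
    obtain s :: "'e \<Rightarrow> int" where s: "\<forall>e\<in>S - {e}. \<bar>s e\<bar> = 1"
      "\<forall>v. (\<Sum>e\<in>S - {e}. s e * (of_bool (h e = v) - of_bool (t e = v))) = 0"
      using less.hyps[of "S - {e}" h t, OF card_Diff1_less[OF fin e(1)] finite_Diff[OF fin] par] by (elim exE conjE)
    have "(\<Sum>f\<in>S. (s(e := 1)) f * (of_bool (h f = v) - of_bool (t f = v))) = 0" for v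
    proof -
      have "(\<Sum>f\<in>S - {e}. (s(e := 1)) f * (of_bool (h f = v) - of_bool (t f = v))) = 0"
        using s(2) by (subst sum.cong[OF refl, where h = "\<lambda>f. s f * (of_bool (h f = v) - of_bool (t f = v))"]) auto
      then show ?thesis
        using e(2) sum.remove[OF fin e(1), of "\<lambda>f. (s(e := 1)) f * (of_bool (h f = v) - of_bool (t f = v))"]
        by simp
    qed
    then show ?thesis
      using s(1) by (intro exI[of _ "s(e := 1)"]) auto
  next
    case noloop: False
    show ?thesis
    proof (cases "S = {}")
      case True
      then show ?thesis by simp
    next
      case False
      then obtain e where e: "e \<in> S" by blast
      define v where "v = h e"
      have te: "t e \<noteq> v"
        using noloop e by (auto simp: v_def)
      have "odd (\<Sum>e\<in>S - {e}. of_bool (h e = v) + of_bool (t e = v) :: int)"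
        using even[of v] te sum.remove[OF fin e, of "\<lambda>e. of_bool (h e = v) + of_bool (t e = v) :: int"]
        by (simp add: v_def)
      then have "\<exists>f\<in>S - {e}. odd (of_bool (h f = v) + of_bool (t f = v) :: int)"
        using dvd_sum[of "S - {e}" 2 "\<lambda>e. of_bool (h e = v) + of_bool (t e = v) :: int"] by blast
      then obtain f where fS: "f \<in> S" "f \<noteq> e" and "odd (of_bool (h f = v) + of_bool (t f = v) :: int)"
        by blast
      then have f: "f \<in> S" "f \<noteq> e" "h f = v \<or> t f = v"
        by (cases "h f = v"; cases "t f = v"; simp)+
      have split: "(\<Sum>a\<in>S. g a) = (\<Sum>a\<in>S - {e} - {f}. g a) + g f + g e" for g :: "'e \<Rightarrow> int"
        using sum.remove[OF fin e, of g] sum.remove[of "S - {e}" f g] fin f by simp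
      have split': "(\<Sum>a\<in>S - {e}. g a) = (\<Sum>a\<in>S - {e} - {f}. g a) + g f" for g :: "'e \<Rightarrow> int"
        using sum.remove[of "S - {e}" f g] fin f by simp
      \<comment> \<open>The merged edge ends in \<open>t e\<close> in place of \<open>v\<close>; the sign \<open>k\<close> tells whether \<open>e\<close> and \<open>f\<close> are
        consecutive at \<open>v\<close> as given, or one of them has to be reversed.\<close>
      define t' where "t' = (if t f = v then t(f := t e) else t)"
      define h' where "h' = (if t f = v then h else h(f := t e))"
      define k :: int where "k = (if t f = v then 1 else -1)"
      have rest: "h' a = h a" "t' a = t a" if "a \<noteq> f" for a
        using that by (auto simp: h'_def t'_def)
      have par: "even (\<Sum>a\<in>S - {e}. of_bool (h' a = w) + of_bool (t' a = w) :: int)" for w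
      proof -
        have "(\<Sum>a\<in>S - {e} - {f}. of_bool (h' a = w) + of_bool (t' a = w) :: int)
            = (\<Sum>a\<in>S - {e} - {f}. of_bool (h a = w) + of_bool (t a = w))"
          by (intro sum.cong refl) (auto simp: rest)
        moreover have "even (of_bool (h' f = w) + of_bool (t' f = w) -
            (of_bool (h f = w) + of_bool (t f = w) + (of_bool (h e = w) + of_bool (t e = w))) :: int)"
          using f(3) by (auto simp: h'_def t'_def v_def)
        moreover note even[of w, unfolded split[of "\<lambda>a. of_bool (h a = w) + of_bool (t a = w)"]]
        ultimately show ?thesis
          unfolding split'[of "\<lambda>a. of_bool (h' a = w) + of_bool (t' a = w)"]
          by (simp only: even_add even_diff) blast
      qed
      obtain s :: "'e \<Rightarrow> int" where s: "\<forall>a\<in>S - {e}. \<bar>s a\<bar> = 1"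
        "\<forall>w. (\<Sum>a\<in>S - {e}. s a * (of_bool (h' a = w) - of_bool (t' a = w))) = 0"
        using less.hyps[of "S - {e}" h' t', OF card_Diff1_less[OF fin e] finite_Diff[OF fin] par] by (elim exE conjE)
      let ?s = "s(e := k * s f)"
      have "(\<Sum>a\<in>S. ?s a * (of_bool (h a = w) - of_bool (t a = w))) = 0" for w
      proof -
        have "(\<Sum>a\<in>S - {e} - {f}. ?s a * (of_bool (h a = w) - of_bool (t a = w)))
            = (\<Sum>a\<in>S - {e} - {f}. s a * (of_bool (h' a = w) - of_bool (t' a = w)))"
          by (intro sum.cong refl) (auto simp: rest)
        moreover have "s f * (of_bool (h' f = w) - of_bool (t' f = w)) =
            ?s f * (of_bool (h f = w) - of_bool (t f = w)) + ?s e * (of_bool (h e = w) - of_bool (t e = w))"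
          using f by (cases "t f = v") (simp_all add: h'_def t'_def v_def k_def algebra_simps)
        moreover note s(2)[rule_format, of w, unfolded split'[of "\<lambda>a. s a * (of_bool (h' a = w) - of_bool (t' a = w))"]]
        ultimately show ?thesis
          unfolding split[of "\<lambda>a. ?s a * (of_bool (h a = w) - of_bool (t a = w))"]
          by (simp only: add.assoc)
      qed
      moreover have "\<forall>a\<in>S. \<bar>?s a\<bar> = 1"
        using s(1) f by (auto simp: k_def)
      ultimately show ?thesis
        by blast
    qed
  qed
qed

definition boundary :: "('v, 'e) pre_digraph \<Rightarrow> ('e \<Rightarrow> int) \<Rightarrow> 'v \<Rightarrow> int" where
  "boundary G z v = (\<Sum>e\<in>arcs G. z e * (of_bool (head G e = v) - of_bool (tail G e = v)))"

lemma boundary_add_scaled: "boundary G (\<lambda>e. x e + a * y e) v = boundary G x v + a * boundary G y v"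
  unfolding boundary_def sum_distrib_left
  by (simp add: sum.distrib[symmetric] distrib_right mult.assoc)

lemma H1_iff_boundary:
  assumes "fin_digraph G"
  shows "z \<in> H1 G \<longleftrightarrow> (\<forall>e. e \<notin> arcs G \<longrightarrow> z e = 0) \<and> (\<forall>v. boundary G z v = 0)"
proof -
  interpret fin_digraph G by fact
  have b: "boundary G z v = (\<Sum>e\<in>in_arcs G v. z e) - (\<Sum>e\<in>out_arcs G v. z e)" for v
  proof -
    have "(\<Sum>e\<in>arcs G. z e * of_bool (head G e = v)) = (\<Sum>e\<in>in_arcs G v. z e)"
      by (rule sum.mono_neutral_cong_right) auto
    moreover have "(\<Sum>e\<in>arcs G. z e * of_bool (tail G e = v)) = (\<Sum>e\<in>out_arcs G v. z e)"
      by (rule sum.mono_neutral_cong_right) auto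
    ultimately show ?thesis
      unfolding boundary_def right_diff_distrib sum_subtractf by simp
  qed
  have "boundary G z v = 0" if "v \<notin> verts G" for v
    unfolding boundary_def using that by (intro sum.neutral) auto
  then show ?thesis
    unfolding H1_def using b by auto
qed

text \<open>
  The edges on which a cycle \<open>z\<close> is odd form a graph with even degrees; a balanced orientation of it is
  a cycle \<open>x\<close> with entries in \<open>{-1, 0, 1}\<close> and with the parities of \<open>z\<close>, so \<open>(z - x) / 2\<close> is a cycle too.
\<close>

lemma halving_lattice_H1:
  assumes G: "fin_digraph G"
  shows "halving_lattice (arcs G) (H1 G)"
proof
  interpret fin_digraph G by fact
  note iff = H1_iff_boundary[OF G]
  show "finite (arcs G)" by simp
  show "z e = 0" if "z \<in> H1 G" "e \<notin> arcs G" for z e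
    using that by (simp add: iff)
  show "(\<lambda>_. 0) \<in> H1 G"
    by (simp add: iff boundary_def)
  show "(\<lambda>e. x e + y e) \<in> H1 G" if "x \<in> H1 G" "y \<in> H1 G" for x y
    using that boundary_add_scaled[of G x 1 y] by (simp add: iff)
  show "(\<lambda>e. a * x e) \<in> H1 G" if "x \<in> H1 G" for a x
    using that boundary_add_scaled[of G "\<lambda>_. 0" a x] by (simp add: iff boundary_def)
  show "\<exists>y\<in>H1 G. \<forall>e. \<bar>z e - 2 * y e\<bar> \<le> 1" if z: "z \<in> H1 G" for z
  proof -
    define S where "S = {e \<in> arcs G. odd (z e)}"
    have z0: "boundary G z v = 0" for v
      using z by (simp add: iff)
    have "even (\<Sum>e\<in>S. of_bool (head G e = v) + of_bool (tail G e = v) :: int)" for v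
    proof -
      have "(\<Sum>e\<in>S. of_bool (head G e = v) + of_bool (tail G e = v) :: int)
          = (\<Sum>e\<in>arcs G. of_bool (odd (z e)) * (of_bool (head G e = v) + of_bool (tail G e = v)))"
        unfolding S_def by (rule sum.mono_neutral_cong_left) auto
      also have "\<dots> = (\<Sum>e\<in>arcs G. of_bool (odd (z e)) * (of_bool (head G e = v) + of_bool (tail G e = v))
          + z e * (of_bool (head G e = v) - of_bool (tail G e = v)))"
        using z0[of v] by (simp add: sum.distrib boundary_def)
      also have "even \<dots>"
        by (intro dvd_sum) auto
      finally show ?thesis .
    qed
    then obtain s :: "'b \<Rightarrow> int" where s: "\<forall>e\<in>S. \<bar>s e\<bar> = 1"
      "\<And>v. (\<Sum>e\<in>S. s e * (of_bool (head G e = v) - of_bool (tail G e = v))) = 0"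
      using balanced_signs[of S "head G" "tail G"] by (auto simp: S_def)
    define x where "x e = (if e \<in> S then s e else 0)" for e
    have x0: "boundary G x v = 0" for v
    proof -
      have "boundary G x v = (\<Sum>e\<in>S. s e * (of_bool (head G e = v) - of_bool (tail G e = v)))"
        unfolding boundary_def x_def S_def by (rule sum.mono_neutral_cong_right) auto
      then show ?thesis using s(2) by simp
    qed
    define y where "y e = (z e - x e) div 2" for e
    have small: "\<bar>x e\<bar> \<le> 1" for e
      using s(1) by (simp add: x_def)
    have "even (z e - x e)" for e
    proof (cases "e \<in> S")
      case True
      then have "odd (s e)"
        using s(1) by (metis dvd_abs_iff odd_one)
      then show ?thesis using True by (simp add: x_def S_def)
    next
      case False
      then have "even (z e)"
        using z by (cases "e \<in> arcs G") (auto simp: S_def iff)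
      then show ?thesis using False by (simp add: x_def)
    qed
    then have z_eq: "z e = x e + 2 * y e" for e
      by (simp add: y_def)
    then have "z = (\<lambda>e. x e + 2 * y e)"
      by (rule ext)
    then have "boundary G y v = 0" for v
      using boundary_add_scaled[of G x 2 y v] z0[of v] x0[of v] by simp
    moreover have "y e = 0" if "e \<notin> arcs G" for e
      using that z by (simp add: y_def x_def S_def iff)
    ultimately show ?thesis
      using small by (intro bexI[of _ y]) (auto simp: iff z_eq)
  qed
qed

lemma cycle_basis_eq: "cycle_basis G = lattice_basis (H1 G)"
  by (simp add: fun_eq_iff cycle_basis_def lattice_basis_def)

section \<open>Contraction and reduced graphs\<close>

text \<open>
  This is a contraction only for edges that are not loops: a loop would lose its vertex.
\<close>

definition contract :: "('v, 'e) pre_digraph \<Rightarrow> 'e \<Rightarrow> ('v, 'e) pre_digraph" where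
  "contract G e = (let \<pi> = id(head G e := tail G e) in
     \<lparr>verts = verts G - {head G e}, arcs = arcs G - {e}, tail = \<pi> \<circ> tail G, head = \<pi> \<circ> head G\<rparr>)"

lemma contract_simps [simp]:
  "verts (contract G e) = verts G - {head G e}"
  "arcs (contract G e) = arcs G - {e}"
  "tail (contract G e) f = (id(head G e := tail G e)) (tail G f)"
  "head (contract G e) f = (id(head G e := tail G e)) (head G f)"
  by (simp_all add: contract_def Let_def)

lemma connected_iff_rtrancl_on:
  "Digraph_Component.connected G \<longleftrightarrow> verts G \<noteq> {} \<and>
    (\<forall>u\<in>verts G. \<forall>v\<in>verts G.
      (u, v) \<in> rtrancl_on (verts G) (\<Union>e\<in>arcs G. {(tail G e, head G e), (head G e, tail G e)}))"
  by (simp add: Digraph_Component.connected_def strongly_connected_def reachable_def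
      parcs_mk_symmetric)

lemma connected_graph_contract:
  assumes G: "connected_graph G" and e: "e \<in> arcs G" "tail G e \<noteq> head G e"
  shows "connected_graph (contract G e)"
proof -
  interpret fin_digraph G
    using G by (simp add: connected_graph_def)
  let ?\<pi> = "id(head G e := tail G e)"
  let ?R = "\<lambda>G. \<Union>e\<in>arcs G. {(tail G e, head G e), (head G e, tail G e)}"
  let ?G = "contract G e"
  have \<pi>: "?\<pi> v \<in> verts ?G" if "v \<in> verts G" for v
    using that e by auto
  have "fin_digraph ?G"
  proof
    fix f assume "f \<in> arcs ?G"
    then have "f \<in> arcs G" by simp
    then show "tail ?G f \<in> verts ?G" "head ?G f \<in> verts ?G"
      using \<pi>[of "tail G f"] \<pi>[of "head G f"] by (simp_all del: fun_upd_apply)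
  qed auto
  moreover have reach: "(?\<pi> u, ?\<pi> v) \<in> rtrancl_on (verts ?G) (?R ?G)"
    if "(u, v) \<in> rtrancl_on (verts G) (?R G)" for u v
    using that
  proof (induction rule: rtrancl_on_induct)
    case base
    then show ?case by (intro rtrancl_on_refl \<pi>)
  next
    case (step x y)
    then obtain f where f: "f \<in> arcs G" "(x, y) = (tail G f, head G f) \<or> (x, y) = (head G f, tail G f)"
      by blast
    show ?case
    proof (cases "f = e")
      case True
      then have "?\<pi> x = ?\<pi> y" using f(2) by auto
      then show ?thesis using step.IH by (simp only:)
    next
      case False
      then have "(?\<pi> x, ?\<pi> y) \<in> ?R ?G"
        using f by (auto simp del: fun_upd_apply)
      then show ?thesis
        by (rule rtrancl_on_into_rtrancl_on[OF step.IH _ \<pi>[OF \<open>y \<in> verts G\<close>]])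
    qed
  qed
  have "Digraph_Component.connected ?G"
    unfolding connected_iff_rtrancl_on
  proof (intro conjI ballI)
    show "verts ?G \<noteq> {}"
      using \<pi>[OF tail_in_verts[OF e(1)]] by blast
    fix u v assume uv: "u \<in> verts ?G" "v \<in> verts ?G"
    then have "(u, v) \<in> rtrancl_on (verts G) (?R G)"
      using G unfolding connected_graph_def connected_iff_rtrancl_on by simp
    from reach[OF this] show "(u, v) \<in> rtrancl_on (verts ?G) (?R ?G)"
      using uv by simp
  qed
  ultimately show ?thesis
    by (simp add: connected_graph_def)
qed

lemma genus_contract:
  assumes G: "fin_digraph G" and e: "e \<in> arcs G" "tail G e \<noteq> head G e"
  shows "genus (contract G e) = genus G"
proof -
  interpret fin_digraph G by fact
  have "card (arcs G) > 0" "card (verts G) > 0"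
    using e(1) head_in_verts[OF e(1)] unfolding card_gt_0_iff by (auto simp del: head_in_verts)
  then show ?thesis
    using e by (simp add: genus_def)
qed

lemma boundary_contract:
  assumes G: "fin_digraph G" and e: "e \<in> arcs G" "tail G e \<noteq> head G e"
    and w: "\<And>f. f \<noteq> e \<Longrightarrow> w f = z f"
  shows "boundary (contract G e) w v =
    (if v = head G e then 0
     else if v = tail G e then boundary G z (tail G e) + boundary G z (head G e)
     else boundary G z v)"
proof -
  interpret fin_digraph G by fact
  let ?\<pi> = "id(head G e := tail G e)"
  have "boundary (contract G e) w v =
      (\<Sum>f\<in>arcs G - {e}. z f * (of_bool (?\<pi> (head G f) = v) - of_bool (?\<pi> (tail G f) = v)))"
    unfolding boundary_def by (intro sum.cong) (auto simp: w simp del: fun_upd_apply)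
  also have "\<dots> = (\<Sum>f\<in>arcs G. z f * (of_bool (?\<pi> (head G f) = v) - of_bool (?\<pi> (tail G f) = v)))"
    by (intro sum.mono_neutral_left) auto
  also have "\<dots> = (if v = head G e then 0
     else if v = tail G e then boundary G z (tail G e) + boundary G z (head G e)
     else boundary G z v)"
    unfolding boundary_def sum.distrib[symmetric] distrib_left[symmetric] if_distrib[of "sum _"]
    using e(2) by (auto intro!: sum.cong sum.neutral)
  finally show ?thesis .
qed

lemma H1_contract_restrict:
  assumes G: "fin_digraph G" and e: "e \<in> arcs G" "tail G e \<noteq> head G e"
    and G': "fin_digraph (contract G e)" and z: "z \<in> H1 G"
  shows "z(e := 0) \<in> H1 (contract G e)"
  using z boundary_contract[OF G e, of "z(e := 0)" z]
  by (auto simp: H1_iff_boundary[OF G] H1_iff_boundary[OF G'])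

text \<open>
  The value at \<open>e\<close> is forced by the vertex \<open>head G e\<close>; the condition at \<open>tail G e\<close> then follows from that
  at the merged vertex.
\<close>

lemma H1_contract_extend:
  assumes G: "fin_digraph G" and e: "e \<in> arcs G" "tail G e \<noteq> head G e"
    and G': "fin_digraph (contract G e)" and w: "w \<in> H1 (contract G e)"
  shows "\<exists>z\<in>H1 G. w = z(e := 0)"
proof -
  interpret fin_digraph G by fact
  define z where "z = w(e := - boundary G w (head G e))"
  have we: "w e = 0"
    using w by (simp add: H1_iff_boundary[OF G'])
  have bz: "boundary G z v = boundary G w v - boundary G w (head G e) *
      (of_bool (head G e = v) - of_bool (tail G e = v))" for v
  proof -
    have "boundary G z v = (\<Sum>f\<in>arcs G. w f * (of_bool (head G f = v) - of_bool (tail G f = v)) +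
        (if f = e then - boundary G w (head G e) * (of_bool (head G e = v) - of_bool (tail G e = v)) else 0))"
      unfolding boundary_def[of G z] by (intro sum.cong refl) (auto simp: z_def we)
    then show ?thesis
      using e(1) by (simp add: sum.distrib boundary_def)
  qed
  have head0: "boundary G z (head G e) = 0"
    using bz[of "head G e"] e(2) by simp
  have "boundary G z v = 0" for v
  proof -
    have "boundary (contract G e) w v = 0"
      using w by (simp add: H1_iff_boundary[OF G'])
    moreover have "w f = z f" if "f \<noteq> e" for f
      using that by (simp add: z_def)
    ultimately show ?thesis
      using boundary_contract[OF G e, of w z v] head0 by (auto split: if_splits)
  qed
  moreover have "z f = 0" if "f \<notin> arcs G" for f
    using that e(1) w by (auto simp: z_def H1_iff_boundary[OF G'])
  ultimately have "z \<in> H1 G"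
    by (simp add: H1_iff_boundary[OF G])
  moreover have "w = z(e := 0)"
    using we by (auto simp: z_def)
  ultimately show ?thesis by blast
qed

lemma H1_zero_if_zero_off_nonloop:
  assumes G: "fin_digraph G" and e: "e \<in> arcs G" "tail G e \<noteq> head G e"
    and z: "z \<in> H1 G" "\<And>f. f \<noteq> e \<Longrightarrow> z f = 0"
  shows "z e = 0"
proof -
  interpret fin_digraph G by fact
  have "boundary G z (head G e) = (\<Sum>f\<in>arcs G. if f = e then z e else 0)"
    unfolding boundary_def using z(2) e(2) by (intro sum.cong refl) auto
  then show ?thesis
    using z(1) e(1) by (simp add: H1_iff_boundary[OF G])
qed

lemma cycle_basis_contract:
  assumes G: "fin_digraph G" and e: "e \<in> arcs G" "tail G e \<noteq> head G e"
    and G': "fin_digraph (contract G e)" and B: "cycle_basis G J B"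
  shows "cycle_basis (contract G e) J (\<lambda>j. (B j)(e := 0))"
proof -
  interpret H: halving_lattice "arcs G" "H1 G"
    by (rule halving_lattice_H1[OF G])
  note B' = B[unfolded cycle_basis_eq]
  let ?f = "\<lambda>z. z(e := 0)"
  have "H1 (contract G e) = ?f ` H1 G"
    using H1_contract_restrict[OF G e G'] H1_contract_extend[OF G e G'] by blast
  moreover have "inj_on ?f (H1 G)"
  proof (rule inj_onI, rule ext)
    fix x y f assume xy: "x \<in> H1 G" "y \<in> H1 G" "?f x = ?f y"
    have off: "x f = y f" if "f \<noteq> e" for f
      using fun_cong[OF xy(3), of f] that by simp
    have "(\<lambda>f. x f + (-1) * y f) \<in> H1 G"
      by (intro H.add_scaled xy)
    from H1_zero_if_zero_off_nonloop[OF G e this] have "x e = y e"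
      using off by simp
    then show "x f = y f"
      using off by (cases "f = e") simp_all
  qed
  then have "lattice_basis (?f ` H1 G) J (\<lambda>j. ?f (B j))"
  proof (rule lattice_basis_map[OF B', rotated])
    show "?f (\<lambda>f. \<Sum>j\<in>J. c j * B j f) = (\<lambda>f. \<Sum>j\<in>J. c j * (?f (B j)) f)" for c
      by (auto simp: fun_eq_iff)
    show "(\<lambda>f. \<Sum>j\<in>J. c j * B j f) \<in> H1 G" for c
      using B' by (intro H.combination) (auto simp: lattice_basis_def)
  qed
  ultimately show ?thesis
    by (simp add: cycle_basis_eq)
qed

lemma loop_in_H1:
  assumes G: "fin_digraph G" and e: "e \<in> arcs G" "tail G e = head G e"
  shows "(\<lambda>f. of_bool (f = e)) \<in> H1 G"
  using e by (auto simp: H1_iff_boundary[OF G] boundary_def intro!: sum.neutral)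

text \<open>
  The hypothesis \<open>loop\<close> serves to exclude that \<open>e\<close> is a loop, in the form in which it is available when
  the column of \<open>e\<close> is zero or proportional to another column.
\<close>

lemma has_riemann_matrix_contract:
  fixes G :: "('v, 'e) pre_digraph"
  assumes G: "connected_graph G"
    and genus: "genus G = CARD('g)" and B: "cycle_basis G UNIV (B :: 'g::finite \<Rightarrow> 'e \<Rightarrow> int)"
    and e: "e \<in> arcs G" and loop: "\<forall>z\<in>H1 G. (\<forall>f. f \<noteq> e \<longrightarrow> z f = 0) \<longrightarrow> z e = 0"
    and l': "\<forall>f\<in>arcs G - {e}. 0 < l' f"
    and Q: "\<forall>i j. (\<Sum>f\<in>arcs G - {e}. real_of_int (B i f) * l' f * real_of_int (B j f)) =
              riemann_matrix G l B $ i $ j"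
  shows "has_riemann_matrix (contract G e) l' (riemann_matrix G l B)"
proof -
  have fin: "fin_digraph G"
    using G by (simp add: connected_graph_def)
  have ends: "tail G e \<noteq> head G e"
    using bspec[OF loop loop_in_H1[OF fin e]] by auto
  have G': "connected_graph (contract G e)"
    by (rule connected_graph_contract[OF G e ends])
  then have fin': "fin_digraph (contract G e)"
    by (simp add: connected_graph_def)
  have "riemann_matrix (contract G e) l' (\<lambda>j. (B j)(e := 0)) = riemann_matrix G l B"
  proof -
    have "(\<Sum>f\<in>arcs G - {e}. real_of_int (((B i)(e := 0)) f) * l' f * real_of_int (((B j)(e := 0)) f)) =
        (\<Sum>f\<in>arcs G - {e}. real_of_int (B i f) * l' f * real_of_int (B j f))" for i j
      by (intro sum.cong refl) auto
    then show ?thesis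
      unfolding riemann_matrix_def[of "contract G e"] vec_eq_iff by (simp add: Q)
  qed
  then show ?thesis
    using G' l' genus genus_contract[OF fin e ends] cycle_basis_contract[OF fin e ends fin' B]
    unfolding has_riemann_matrix_def metric_graph_def by auto
qed

text \<open>
  A graph with the fewest edges has this property. Columns that vanish or agree modulo 2 are
  dependent modulo 2, hence integrally dependent by \<open>dependent_relation\<close>: \<open>b\<^sub>e = 0\<close> or \<open>b\<^sub>e = \<plusminus>b\<^sub>f\<close>. Then \<open>e\<close> is
  no loop and can be contracted without changing the Riemann matrix, its length being added to
  that of \<open>f\<close> in the second case.
\<close>

lemma reduced_graph_exists:
  fixes Q :: "real^'g^'g"
  assumes "Q \<in> tropical_schottky_locus"
  shows "\<exists>(G :: (nat, nat) pre_digraph) l (B :: 'g \<Rightarrow> nat \<Rightarrow> int).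
    metric_graph G l \<and> genus G = CARD('g) \<and> cycle_basis G UNIV B \<and> riemann_matrix G l B = Q \<and>
    (\<forall>e\<in>arcs G. \<exists>i. odd (B i e)) \<and>
    (\<forall>e\<in>arcs G. \<forall>f\<in>arcs G. (\<forall>i. even (B i e) \<longleftrightarrow> even (B i f)) \<longrightarrow> e = f)"
proof -
  let ?P = "\<lambda>n. \<exists>(G :: (nat, nat) pre_digraph) l. has_riemann_matrix G l Q \<and> card (arcs G) = n"
  have ex: "\<exists>n. ?P n"
    using assms by (simp add: tropical_schottky_locus_def)
  define n where "n = (LEAST n. ?P n)"
  have "?P n"
    unfolding n_def by (rule LeastI_ex[OF ex])
  then obtain G :: "(nat, nat) pre_digraph" and l where Gl: "has_riemann_matrix G l Q" "card (arcs G) = n"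
    by (elim exE conjE)
  have minimal: "n \<le> card (arcs G')" if "has_riemann_matrix G' l' Q" for G' :: "(nat, nat) pre_digraph" and l'
    unfolding n_def by (rule Least_le) (use that in blast)
  from Gl(1) obtain B :: "'g \<Rightarrow> nat \<Rightarrow> int" where
    mG: "metric_graph G l" and genus: "genus G = CARD('g)" and B: "cycle_basis G UNIV B"
    and Q: "riemann_matrix G l B = Q"
    unfolding has_riemann_matrix_def by (elim exE conjE)
  have cG: "connected_graph G" and l: "\<forall>f\<in>arcs G. 0 < l f"
    using mG by (simp_all add: metric_graph_def)
  then interpret fin_digraph G
    by (simp add: connected_graph_def)
  interpret H: halving_lattice "arcs G" "H1 G"
    by (rule halving_lattice_H1) (rule fin_digraph)
  note B' = B[unfolded cycle_basis_eq]
  have BH: "B i \<in> H1 G" for i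
    by (rule lattice_basis_mem[OF B' UNIV_I])
  have no_contraction: False
    if e: "e \<in> arcs G" and loop: "\<forall>z\<in>H1 G. (\<forall>f. f \<noteq> e \<longrightarrow> z f = 0) \<longrightarrow> z e = 0"
      and l': "\<forall>f\<in>arcs G - {e}. 0 < l' f"
      and Q': "\<forall>i j. (\<Sum>f\<in>arcs G - {e}. real_of_int (B i f) * l' f * real_of_int (B j f)) =
              riemann_matrix G l B $ i $ j" for e l'
  proof -
    have "has_riemann_matrix (contract G e) l' Q"
      using has_riemann_matrix_contract[OF cG genus B e loop l' Q'] by (simp add: Q)
    then have "n \<le> card (arcs G - {e})"
      using minimal by fastforce
    then show False
      using card_Diff1_less[OF finite_arcs e] Gl(2) by linarith
  qed
  have Qij: "riemann_matrix G l B $ i $ j =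
      real_of_int (B i e) * l e * real_of_int (B j e) +
      (\<Sum>f\<in>arcs G - {e}. real_of_int (B i f) * l f * real_of_int (B j f))" if "e \<in> arcs G" for i j e
    unfolding riemann_matrix_def by (simp add: sum.remove[OF finite_arcs that])
  have nonzero: "\<exists>i. odd (B i e)" if e: "e \<in> arcs G" for e
  proof (rule ccontr)
    assume "\<nexists>i. odd (B i e)"
    then have ev: "even (B i e)" for i by blast
    have "\<not> shattered (H1 G) {e}"
    proof
      assume "shattered (H1 G) {e}"
      then obtain z where z: "z \<in> H1 G" "z e = 1"
        by (auto simp: shattered_def)
      from lattice_basis_span[OF B' z(1)] obtain c where c: "z = (\<lambda>e. \<Sum>j\<in>UNIV. c j * B j e)" ..
      have "even (z e)"
        unfolding c by (intro dvd_sum dvd_mult ev)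
      then show False using z(2) by simp
    qed
    from H.dependent_relation[OF _ this] have z0: "z e = 0" if "z \<in> H1 G" for z
      using that by fastforce
    show False
    proof (rule no_contraction[OF e, of l])
      show "\<forall>z\<in>H1 G. (\<forall>f. f \<noteq> e \<longrightarrow> z f = 0) \<longrightarrow> z e = 0"
        using z0 by blast
      show "\<forall>f\<in>arcs G - {e}. 0 < l f" using l by blast
      show "\<forall>i j. (\<Sum>f\<in>arcs G - {e}. real_of_int (B i f) * l f * real_of_int (B j f)) =
          riemann_matrix G l B $ i $ j"
        unfolding Qij[OF e] using z0[OF BH] by simp
    qed
  qed
  have distinct: "e = f" if e: "e \<in> arcs G" and f: "f \<in> arcs G" and par: "\<And>i. even (B i e) \<longleftrightarrow> even (B i f)" for e f
  proof (rule ccontr)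
    assume ef: "e \<noteq> f"
    have evz: "even (z e + z f)" if "z \<in> H1 G" for z
    proof -
      from lattice_basis_span[OF B' that] obtain c where c: "z = (\<lambda>e. \<Sum>j\<in>UNIV. c j * B j e)" ..
      have "even (B j e + B j f)" for j
        using par[of j] by simp
      then show ?thesis
        unfolding c sum.distrib[symmetric] distrib_left[symmetric] by (intro dvd_sum dvd_mult)
    qed
    have "\<not> shattered (H1 G) {e, f}"
    proof
      assume "shattered (H1 G) {e, f}"
      then obtain z where "z \<in> H1 G" "\<forall>x\<in>{e, f}. z x = of_bool (x = e)"
        unfolding shattered_def by blast
      then show False using evz[of z] ef by simp
    qed
    from H.dependent_relation[OF _ this] obtain a c where a: "a \<in> {e, f}"
      and small: "\<forall>k. \<bar>c k\<bar> \<le> (1::int)" and rel: "\<forall>z\<in>H1 G. z a = (\<Sum>k\<in>{e, f} - {a}. c k * z k)"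
      by auto
    define b where "b = (if a = e then f else e)"
    have ab: "a \<in> arcs G" "b \<in> arcs G" "a \<noteq> b" "{e, f} - {a} = {b}"
      using a e f ef by (auto simp: b_def)
    have rel': "z a = c b * z b" if "z \<in> H1 G" for z
      using bspec[OF rel that] unfolding ab(4) by simp
    have "c b \<noteq> 0"
    proof
      assume "c b = 0"
      then have "B i a = 0" for i
        using rel'[OF BH, of i] by simp
      then show False
        using nonzero[OF ab(1)] by simp
    qed
    then have cb: "\<bar>c b\<bar> = 1"
      using small[rule_format, of b] by linarith
    then have "c b * c b = 1"
      by (rule unit_square)
    then have cb2: "real_of_int (c b) * real_of_int (c b) = 1"
      by (metis of_int_1 of_int_mult)
    show False
    proof (rule no_contraction[OF ab(1), of "l(b := l b + l a)"])
      show "\<forall>z\<in>H1 G. (\<forall>f. f \<noteq> a \<longrightarrow> z f = 0) \<longrightarrow> z a = 0"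
      proof (intro ballI impI)
        fix z assume z: "z \<in> H1 G" "\<forall>f. f \<noteq> a \<longrightarrow> z f = 0"
        then show "z a = 0"
          using rel'[OF z(1)] ab(3) by simp
      qed
      show "\<forall>f\<in>arcs G - {a}. 0 < (l(b := l b + l a)) f"
        using l ab(1,2) by (auto intro: add_pos_pos)
      show "\<forall>i j. (\<Sum>f\<in>arcs G - {a}. real_of_int (B i f) * (l(b := l b + l a)) f * real_of_int (B j f)) =
          riemann_matrix G l B $ i $ j"
      proof (intro allI)
        fix i j
        let ?t = "\<lambda>l f. real_of_int (B i f) * l f * real_of_int (B j f)"
        have b: "b \<in> arcs G - {a}" "finite (arcs G - {a})"
          using ab by auto
        have "(\<Sum>f\<in>arcs G - {a}. ?t (l(b := l b + l a)) f)
            = ?t (l(b := l b + l a)) b + (\<Sum>f\<in>arcs G - {a} - {b}. ?t (l(b := l b + l a)) f)"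
          by (rule sum.remove[OF b(2,1)])
        also have "(\<Sum>f\<in>arcs G - {a} - {b}. ?t (l(b := l b + l a)) f) = (\<Sum>f\<in>arcs G - {a} - {b}. ?t l f)"
          by (intro sum.cong refl) auto
        also have "?t (l(b := l b + l a)) b = ?t l b + ?t l a"
          using cb2 rel'[OF BH, of i] rel'[OF BH, of j]
          by (simp add: algebra_simps)
        also have "?t l b + ?t l a + (\<Sum>f\<in>arcs G - {a} - {b}. ?t l f) = ?t l a + (\<Sum>f\<in>arcs G - {a}. ?t l f)"
          using sum.remove[OF b(2,1), of "?t l"] by simp
        finally show "(\<Sum>f\<in>arcs G - {a}. ?t (l(b := l b + l a)) f) = riemann_matrix G l B $ i $ j"
          unfolding Qij[OF ab(1)] .
      qed
    qed
  qed
  show ?thesis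
    using mG genus B Q nonzero distinct by (intro exI[of _ G] exI[of _ l] exI[of _ B]) simp
qed

section \<open>Theta constants of a Riemann matrix\<close>

definition cycle_with_coordinates :: "('g::finite \<Rightarrow> 'e \<Rightarrow> int) \<Rightarrow> real^'g \<Rightarrow> 'e \<Rightarrow> real" where
  "cycle_with_coordinates B x e = (\<Sum>i\<in>UNIV. x $ i * real_of_int (B i e))"

lemma cycle_with_coordinates_scaleR: "cycle_with_coordinates B (a *\<^sub>R x) e = a * cycle_with_coordinates B x e"
  by (simp add: cycle_with_coordinates_def sum_distrib_left mult.assoc)

lemma cycle_with_coordinates_real_vec:
  "cycle_with_coordinates B (real_vec u) e = real_of_int (\<Sum>i\<in>UNIV. u $ i * B i e)"
  by (simp add: cycle_with_coordinates_def real_vec_def)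

lemma riemann_matrix_form:
  fixes B :: "'g::finite \<Rightarrow> 'e \<Rightarrow> int"
  shows "x \<bullet> (riemann_matrix G l B *v y) = (\<Sum>e\<in>arcs G. l e * (cycle_with_coordinates B x e * cycle_with_coordinates B y e))"
proof -
  have "x \<bullet> (riemann_matrix G l B *v y) =
      (\<Sum>i\<in>UNIV. \<Sum>j\<in>UNIV. \<Sum>e\<in>arcs G. l e * ((x $ i * real_of_int (B i e)) * (y $ j * real_of_int (B j e))))"
    by (simp add: inner_vec_def matrix_vector_mult_def riemann_matrix_def sum_distrib_left
        sum_distrib_right ac_simps)
  also have "\<dots> = (\<Sum>e\<in>arcs G. \<Sum>i\<in>UNIV. \<Sum>j\<in>UNIV. l e * ((x $ i * real_of_int (B i e)) * (y $ j * real_of_int (B j e))))"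
    by (subst sum.swap, subst sum.swap[of _ "arcs G"]) (rule refl)
  also have "\<dots> = (\<Sum>e\<in>arcs G. l e * (cycle_with_coordinates B x e * cycle_with_coordinates B y e))"
    unfolding cycle_with_coordinates_def sum_product by (simp add: sum_distrib_left)
  finally show ?thesis .
qed

text \<open>
  Completing the square turns the maximum over \<open>k\<close> into the minimum of \<open>\<Sum>e. l e * (n u e - 2 * n k e)\<^sup>2\<close>,
  where \<open>n k\<close> is the cycle with coordinates \<open>k\<close>. Each square is at least 1 if \<open>n u e\<close> is odd
  and at least 0 otherwise, and halving the cycle \<open>n u\<close> makes all these bounds sharp for the same \<open>k\<close>.
\<close>

lemma theta_char_riemann:
  fixes B :: "'g::finite \<Rightarrow> 'e \<Rightarrow> int"
  assumes G: "metric_graph G l" and B: "cycle_basis G UNIV B"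
  shows "theta_char (riemann_matrix G l B) u =
    - (1/4) * (\<Sum>e\<in>arcs G. l e * of_bool (odd (\<Sum>i\<in>UNIV. u $ i * B i e)))"
proof -
  let ?Q = "riemann_matrix G l B"
  define n :: "int^'g \<Rightarrow> 'e \<Rightarrow> int" where "n k e = (\<Sum>i\<in>UNIV. k $ i * B i e)" for k e
  have fin: "fin_digraph G" and l: "\<And>e. e \<in> arcs G \<Longrightarrow> 0 < l e"
    using G by (simp_all add: metric_graph_def connected_graph_def)
  interpret H: halving_lattice "arcs G" "H1 G"
    by (rule halving_lattice_H1[OF fin])
  note B' = B[unfolded cycle_basis_eq]
  define val where "val k = real_vec k \<bullet> (?Q *v ((1/2) *\<^sub>R real_vec u)) -
      1/2 * (real_vec k \<bullet> (?Q *v real_vec k))" for k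
  define best where "best = (\<Sum>e\<in>arcs G. l e * ((real_of_int (n u e))\<^sup>2 - of_bool (odd (n u e))) / 8)"
  have val_eq: "val k = (\<Sum>e\<in>arcs G. l e * ((real_of_int (n u e))\<^sup>2 - (real_of_int (n u e - 2 * n k e))\<^sup>2) / 8)" for k
    unfolding val_def riemann_matrix_form cycle_with_coordinates_scaleR cycle_with_coordinates_real_vec n_def[symmetric]
      sum_distrib_left sum_subtractf[symmetric]
    by (intro sum.cong refl) (simp add: power2_eq_square field_simps)
  have "val k \<le> best" for k
    unfolding val_eq best_def
  proof (intro sum_mono divide_right_mono mult_left_mono diff_left_mono)
    fix e assume "e \<in> arcs G"
    then show "0 \<le> l e" using l by fastforce
    show "of_bool (odd (n u e)) \<le> (real_of_int (n u e - 2 * n k e))\<^sup>2"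
    proof (cases "odd (n u e)")
      case True
      then have "n u e - 2 * n k e \<noteq> 0" by presburger
      then have "1 \<le> \<bar>real_of_int (n u e - 2 * n k e)\<bar>" by linarith
      then have "1 \<le> (real_of_int (n u e - 2 * n k e))\<^sup>2"
        using one_le_power[of "\<bar>real_of_int (n u e - 2 * n k e)\<bar>" 2] by (simp only: power2_abs)
      then show ?thesis using True by (simp del: of_int_diff)
    qed simp
  qed simp
  moreover obtain k where "val k = best"
  proof -
    have "n u \<in> H1 G"
      unfolding n_def[abs_def] by (rule H.combination) (simp_all add: lattice_basis_mem[OF B'])
    from H.halve[OF this] obtain y where y: "y \<in> H1 G" "\<forall>e. \<bar>n u e - 2 * y e\<bar> \<le> 1"
      by (elim bexE)
    from lattice_basis_span[OF B' y(1)] obtain c where c: "y = (\<lambda>e. \<Sum>j\<in>UNIV. c j * B j e)" ..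
    have yk: "y e = n (\<chi> j. c j) e" for e
      by (simp add: c n_def)
    have "val (\<chi> j. c j) = best"
      unfolding val_eq best_def
    proof (intro sum.cong refl)
      fix e
      have "n u e - 2 * y e = -1 \<or> n u e - 2 * y e = 0 \<or> n u e - 2 * y e = 1"
        using y(2)[rule_format, of e] by arith
      then have "(real_of_int (n u e - 2 * y e))\<^sup>2 = of_bool (odd (n u e))"
        by (elim disjE) (auto, presburger+)
      then show "l e * ((real_of_int (n u e))\<^sup>2 - (real_of_int (n u e - 2 * n (\<chi> j. c j) e))\<^sup>2) / 8 =
          l e * ((real_of_int (n u e))\<^sup>2 - of_bool (odd (n u e))) / 8"
        by (simp only: yk)
    qed
    then show thesis by (rule that)
  qed
  ultimately have "(SUP k. val k) = best"
    by (intro cSup_eq_maximum) (blast, fast)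
  then have "trop_theta ?Q ((1/2) *\<^sub>R real_vec u) = best"
    by (simp add: trop_theta_def val_def)
  moreover have "real_vec u \<bullet> (?Q *v real_vec u) = (\<Sum>e\<in>arcs G. l e * (real_of_int (n u e))\<^sup>2)"
    unfolding riemann_matrix_form cycle_with_coordinates_real_vec n_def[symmetric] by (simp add: power2_eq_square)
  ultimately have "theta_char ?Q u = 2 * best - 1/4 * (\<Sum>e\<in>arcs G. l e * (real_of_int (n u e))\<^sup>2)"
    by (simp add: theta_char_def)
  also have "\<dots> = - (1/4) * (\<Sum>e\<in>arcs G. l e * of_bool (odd (n u e)))"
    unfolding best_def sum_distrib_left sum_subtractf[symmetric]
    by (intro sum.cong refl) (simp add: field_simps)
  finally show ?thesis
    unfolding n_def .
qed

definition bit_character :: "('g::finite \<Rightarrow> int) \<Rightarrow> bit^'g \<Rightarrow> real" where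
  "bit_character w u = (-1) powi (\<Sum>i\<in>UNIV. lift_bits u $ i * w i)"

lemma minus_one_powi: "(-1 :: real) powi n = 1 - 2 * of_bool (odd n)"
  by (cases "even n") (auto simp: power_int_def even_nat_iff minus_one_power_iff nat_minus_as_int)

text \<open>
  If \<open>w i\<close> is odd, flipping the bit \<open>i\<close> changes the sign of the character, so the terms of the sum cancel.
\<close>

lemma sum_bit_character:
  fixes w :: "'g::finite \<Rightarrow> int"
  shows "(\<Sum>u\<in>UNIV. bit_character w u) = (if \<forall>i. even (w i) then 2 ^ CARD('g) else 0)"
proof (cases "\<forall>i. even (w i)")
  case True
  have "bit_character w u = 1" for u
  proof -
    have "even (\<Sum>i\<in>UNIV. lift_bits u $ i * w i)"
      using True by (intro dvd_sum) simp
    then show ?thesis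
      by (simp add: bit_character_def minus_one_powi)
  qed
  moreover have "CARD(bit) = 2"
  proof -
    have "(UNIV :: bit set) = {0, 1}"
      by (auto simp: bit_not_zero_iff[symmetric] simp del: bit_not_zero_iff)
    show ?thesis
      unfolding \<open>UNIV = {0, 1}\<close> by simp
  qed
  ultimately show ?thesis
    using True by simp
next
  case False
  then obtain i where i: "odd (w i)" by blast
  define flip :: "bit^'g \<Rightarrow> bit^'g" where
    "flip u = (\<chi> j. if j = i then (if u $ j = 0 then 1 else 0) else u $ j)" for u
  have "flip (flip u) = u" for u
    by (simp add: flip_def vec_eq_iff)
  then have bij: "bij flip"
    by (rule involuntory_imp_bij)
  have "bit_character w (flip u) = - bit_character w u" for u
  proof -
    have "(\<Sum>j\<in>UNIV. lift_bits (flip u) $ j * w j) - (\<Sum>j\<in>UNIV. lift_bits u $ j * w j)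
        = (\<Sum>j\<in>UNIV. if j = i then (if u $ i = 0 then w i else - w i) else 0)"
      unfolding sum_subtractf[symmetric]
      by (intro sum.cong refl) (auto simp: lift_bits_def flip_def)
    then have "odd ((\<Sum>j\<in>UNIV. lift_bits (flip u) $ j * w j) - (\<Sum>j\<in>UNIV. lift_bits u $ j * w j))"
      using i by simp
    then show ?thesis
      unfolding bit_character_def minus_one_powi by auto
  qed
  then have "(\<Sum>u\<in>UNIV. bit_character w u) = - (\<Sum>u\<in>UNIV. bit_character w u)"
    using sum.reindex_bij_betw[OF bij, of "bit_character w"] by (simp add: sum_negf)
  then show ?thesis
    using False by simp
qed

lemma bit_character_mult: "bit_character v u * bit_character w u = bit_character (\<lambda>i. v i + w i) u"
  unfolding bit_character_def by (simp add: distrib_left sum.distrib power_int_add)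

text \<open>
  The indicator of \<open>odd (u \<bullet> b)\<close> is \<open>(1 - (-1) powi (u \<bullet> b)) / 2\<close> for a column \<open>b\<close>; orthogonality of characters
  therefore picks out the columns congruent to \<open>v\<close>. The vector \<open>v\<close> must not vanish modulo 2, since
  otherwise the constant term would contribute.
\<close>

lemma theta_const_riemann:
  fixes B :: "'g::finite \<Rightarrow> 'e \<Rightarrow> int"
  assumes G: "metric_graph G l" and B: "cycle_basis G UNIV B" and v: "\<not> (\<forall>i. even (v $ i))"
  shows "theta_const (riemann_matrix G l B) v =
    2 ^ CARD('g) / 8 * (\<Sum>e\<in>arcs G. l e * of_bool (\<forall>i. even (v $ i) \<longleftrightarrow> even (B i e)))"
proof -
  let ?v = "\<lambda>i. v $ i" and ?b = "\<lambda>e i. B i e"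
  have odd: "of_bool (odd (\<Sum>i\<in>UNIV. lift_bits u $ i * B i e)) = (1 - bit_character (?b e) u) / 2" for u e
    by (simp add: bit_character_def minus_one_powi)
  have "theta_const (riemann_matrix G l B) v =
      (\<Sum>u\<in>UNIV. bit_character ?v u * (- (1/4) * (\<Sum>e\<in>arcs G. l e * ((1 - bit_character (?b e) u) / 2))))"
    unfolding theta_const_def theta_char_riemann[OF G B] odd bit_character_def[symmetric] ..
  also have "\<dots> = (\<Sum>u\<in>UNIV. \<Sum>e\<in>arcs G. - (1/8) * l e *
      (bit_character ?v u - bit_character (\<lambda>i. v $ i + B i e) u))"
    unfolding sum_distrib_left
    by (intro sum.cong refl) (simp add: bit_character_mult[symmetric] field_simps)
  also have "\<dots> = (\<Sum>e\<in>arcs G. \<Sum>u\<in>UNIV. - (1/8) * l e *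
      (bit_character ?v u - bit_character (\<lambda>i. v $ i + B i e) u))"
    by (rule sum.swap)
  also have "\<dots> = (\<Sum>e\<in>arcs G. 2 ^ CARD('g) / 8 * (l e * of_bool (\<forall>i. even (v $ i) \<longleftrightarrow> even (B i e))))"
  proof (intro sum.cong refl)
    fix e
    show "(\<Sum>u\<in>UNIV. - (1/8) * l e * (bit_character ?v u - bit_character (\<lambda>i. v $ i + B i e) u)) =
        2 ^ CARD('g) / 8 * (l e * of_bool (\<forall>i. even (v $ i) \<longleftrightarrow> even (B i e)))"
      unfolding sum_distrib_left[symmetric] sum_subtractf sum_bit_character
      using v by auto
  qed
  finally show ?thesis
    unfolding sum_distrib_left .
qed

definition column_mod2 :: "('g::finite \<Rightarrow> 'e \<Rightarrow> int) \<Rightarrow> 'e \<Rightarrow> bit^'g" where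
  "column_mod2 B e = (\<chi> i. of_int (B i e))"

lemma of_int_bit: "(of_int k :: bit) = of_bool (odd k)"
proof (cases "even k")
  case True
  then obtain m where "k = 2 * m" by blast
  then show ?thesis by simp
next
  case False
  then obtain m where "k = 2 * m + 1" by (rule oddE)
  then show ?thesis by simp
qed

lemma even_lift_bits: "even (lift_bits v $ i) \<longleftrightarrow> v $ i = 0"
  by (cases "v $ i") (simp_all add: lift_bits_def)

lemma column_mod2_eq_iff:
  "column_mod2 B e = v \<longleftrightarrow> (\<forall>i. even (lift_bits v $ i) \<longleftrightarrow> even (B i e))"
proof -
  have "of_int (B i e) = v $ i \<longleftrightarrow> (even (lift_bits v $ i) \<longleftrightarrow> even (B i e))" for i
    by (cases "v $ i") (simp_all add: of_int_bit even_lift_bits)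
  then show ?thesis
    by (simp add: column_mod2_def vec_eq_iff)
qed

lemma theta_length_riemann:
  fixes B :: "'g::finite \<Rightarrow> 'e \<Rightarrow> int"
  assumes G: "metric_graph G l" and B: "cycle_basis G UNIV B" and v: "v \<noteq> 0"
  shows "theta_length (riemann_matrix G l B) v = (\<Sum>e\<in>arcs G. l e * of_bool (column_mod2 B e = v))"
proof -
  have "\<not> (\<forall>i. even (lift_bits v $ i))"
    using v by (simp add: even_lift_bits vec_eq_iff)
  note const = theta_const_riemann[OF G B this]
  have one: "2 powi (3 - int CARD('g)) * (2 ^ CARD('g) / 8) = (1 :: real)"
    by (simp add: power_int_diff)
  show ?thesis
    unfolding theta_length_def column_mod2_eq_iff const mult.assoc[symmetric] one by simp
qed

section \<open>The theta matroid and its labelled graphs\<close>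

lemma cographic_independent_iff_shattered:
  assumes G: "fin_digraph G" and B: "cycle_basis G {..<genus G} B" and I: "I \<subseteq> arcs G"
  shows "I \<in> snd (cographic_matroid G) \<longleftrightarrow> shattered (H1 G) I"
proof -
  interpret halving_lattice "arcs G" "H1 G"
    by (rule halving_lattice_H1[OF G])
  have "finite I"
    using I finite_E finite_subset by blast
  from independent_columns_iff_shattered[OF B[unfolded cycle_basis_eq] this, where ?'k = real]
  show ?thesis
    using I by (simp add: cographic_matroid_eq[OF B] represented_matroid_def)
qed

lemma theta_independent_iff_shattered:
  fixes B :: "'g::finite \<Rightarrow> 'e \<Rightarrow> int"
  assumes G: "fin_digraph G" and B: "cycle_basis G UNIV B" and I: "I \<subseteq> arcs G"
    and inj: "inj_on (column_mod2 B) (arcs G)"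
    and supp: "theta_support Q = column_mod2 B ` arcs G"
  shows "column_mod2 B ` I \<in> snd (theta_matroid Q) \<longleftrightarrow> shattered (H1 G) I"
proof -
  let ?lab = "column_mod2 B"
  interpret halving_lattice "arcs G" "H1 G"
    by (rule halving_lattice_H1[OF G])
  have fin: "finite I"
    using I finite_E finite_subset by blast
  have injI: "inj_on ?lab I"
    using inj I by (rule inj_on_subset)
  have sum: "(\<Sum>v\<in>?lab ` I. c v * v $ i) = (\<Sum>e\<in>I. c (?lab e) * of_int (B i e))" for c i
    by (simp only: sum.reindex[OF injI] comp_def) (simp only: column_mod2_def vec_lambda_beta)
  have "(\<forall>c. (\<forall>i. (\<Sum>v\<in>?lab ` I. c v * v $ i) = 0) \<longrightarrow> (\<forall>v\<in>?lab ` I. c v = 0)) \<longleftrightarrow>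
      (\<forall>c :: 'e \<Rightarrow> bit. (\<forall>i\<in>UNIV. (\<Sum>e\<in>I. c e * of_int (B i e)) = 0) \<longrightarrow> (\<forall>e\<in>I. c e = 0))"
    (is "?L \<longleftrightarrow> ?R")
  proof
    assume L: ?L
    show ?R
    proof (intro allI impI)
      fix c :: "'e \<Rightarrow> bit"
      assume c: "\<forall>i\<in>UNIV. (\<Sum>e\<in>I. c e * of_int (B i e)) = 0"
      let ?d = "\<lambda>v. c (inv_into I ?lab v)"
      have eq: "(\<Sum>v\<in>?lab ` I. ?d v * v $ i) = (\<Sum>e\<in>I. c e * of_int (B i e))" for i
        unfolding sum by (intro sum.cong refl) (simp only: inv_into_f_f[OF injI])
      have "\<forall>i. (\<Sum>v\<in>?lab ` I. ?d v * v $ i) = 0"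
        unfolding eq using c by blast
      from L[THEN spec, THEN mp, OF this] show "\<forall>e\<in>I. c e = 0"
        by (simp add: inv_into_f_f[OF injI])
    qed
  next
    assume R: ?R
    show ?L
    proof (intro allI impI)
      fix c assume "\<forall>i. (\<Sum>v\<in>?lab ` I. c v * v $ i) = 0"
      then have "\<forall>i\<in>UNIV. (\<Sum>e\<in>I. c (?lab e) * of_int (B i e)) = 0"
        unfolding sum by blast
      from R[THEN spec, THEN mp, OF this] show "\<forall>v\<in>?lab ` I. c v = 0"
        by (simp only: ball_simps)
    qed
  qed
  also have "\<dots> \<longleftrightarrow> shattered (H1 G) I"
    by (rule independent_columns_iff_shattered[OF B[unfolded cycle_basis_eq] fin])
  finally have "(\<forall>c. (\<forall>i. (\<Sum>v\<in>?lab ` I. c v * v $ i) = 0) \<longrightarrow> (\<forall>v\<in>?lab ` I. c v = 0))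
      \<longleftrightarrow> shattered (H1 G) I" .
  moreover have "?lab ` I \<subseteq> theta_support Q"
    using I supp by blast
  ultimately show ?thesis
    by (simp only: theta_matroid_def represented_matroid_def snd_conv mem_Collect_eq ball_UNIV simp_thms)
qed

lemma relabel_cographic_eq_theta_matroid:
  fixes B :: "'g::finite \<Rightarrow> 'e \<Rightarrow> int"
  assumes G: "fin_digraph G" and B: "cycle_basis G UNIV B" and genus: "genus G = CARD('g)"
    and inj: "inj_on (column_mod2 B) (arcs G)"
    and supp: "theta_support Q = column_mod2 B ` arcs G"
  shows "relabel_matroid (column_mod2 B) (cographic_matroid G) = theta_matroid Q"
proof -
  let ?lab = "column_mod2 B"
  obtain h :: "nat \<Rightarrow> 'g" where "bij_betw h {..<genus G} UNIV"
    using ex_bij_betw_nat_finite[OF finite_class.finite_UNIV[where 'a = 'g]]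
    by (auto simp: genus atLeast0LessThan)
  from lattice_basis_reindex[OF B[unfolded cycle_basis_eq] this]
  have B': "cycle_basis G {..<genus G} (\<lambda>j. B (h j))"
    by (simp add: cycle_basis_eq)
  have sub: "I \<subseteq> arcs G" if "I \<in> snd (cographic_matroid G)" for I
    using that by (auto simp: cographic_matroid_def represented_matroid_def)
  have sub': "X \<subseteq> ?lab ` arcs G" if "X \<in> snd (theta_matroid Q)" for X
    using that supp by (auto simp: theta_matroid_def represented_matroid_def)
  have iff: "I \<in> snd (cographic_matroid G) \<longleftrightarrow> ?lab ` I \<in> snd (theta_matroid Q)" if "I \<subseteq> arcs G" for I
    unfolding cographic_independent_iff_shattered[OF G B' that]
      theta_independent_iff_shattered[OF G B that inj supp] ..
  have "(\<lambda>I. ?lab ` I) ` snd (cographic_matroid G) = snd (theta_matroid Q)"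
  proof
    show "(\<lambda>I. ?lab ` I) ` snd (cographic_matroid G) \<subseteq> snd (theta_matroid Q)"
      using sub iff by blast
    show "snd (theta_matroid Q) \<subseteq> (\<lambda>I. ?lab ` I) ` snd (cographic_matroid G)"
    proof
      fix X assume X: "X \<in> snd (theta_matroid Q)"
      from sub'[OF this] obtain I where I: "I \<subseteq> arcs G" "X = ?lab ` I"
        by (auto simp: subset_image_iff)
      then have "I \<in> snd (cographic_matroid G)"
        using X iff by simp
      then show "X \<in> (\<lambda>I. ?lab ` I) ` snd (cographic_matroid G)"
        unfolding I(2) by (rule imageI)
    qed
  qed
  then show ?thesis
    using supp by (simp add: relabel_matroid_def prod_eq_iff cographic_matroid_def
        theta_matroid_def represented_matroid_def)
qed

lemma theta_of_reduced_graph: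
  fixes B :: "'g::finite \<Rightarrow> 'e \<Rightarrow> int"
  assumes mG: "metric_graph G l" and B: "cycle_basis G UNIV B"
    and nonzero: "\<forall>e\<in>arcs G. \<exists>i. odd (B i e)"
    and distinct: "\<forall>e\<in>arcs G. \<forall>f\<in>arcs G. (\<forall>i. even (B i e) \<longleftrightarrow> even (B i f)) \<longrightarrow> e = f"
  shows inj_on_column_mod2: "inj_on (column_mod2 B) (arcs G)"
    and theta_length_column: "e \<in> arcs G \<Longrightarrow> theta_length (riemann_matrix G l B) (column_mod2 B e) = l e"
    and theta_support_eq: "theta_support (riemann_matrix G l B) = column_mod2 B ` arcs G"
proof -
  interpret fin_digraph G
    using mG by (simp add: metric_graph_def connected_graph_def)
  have entry: "column_mod2 B e $ i = 0 \<longleftrightarrow> even (B i e)" for e i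
    by (simp add: column_mod2_def of_int_bit)
  show inj: "inj_on (column_mod2 B) (arcs G)"
    using distinct by (intro inj_onI) (metis entry)
  have col0: "column_mod2 B e \<noteq> 0" if "e \<in> arcs G" for e
    using nonzero that entry by (metis zero_index)
  show len: "theta_length (riemann_matrix G l B) (column_mod2 B e) = l e" if e: "e \<in> arcs G" for e
  proof -
    have "(\<Sum>f\<in>arcs G. l f * of_bool (column_mod2 B f = column_mod2 B e)) =
        (\<Sum>f\<in>arcs G. if f = e then l f else 0)"
      using inj_on_eq_iff[OF inj _ e] by (intro sum.cong refl) simp
    then show ?thesis
      using e unfolding theta_length_riemann[OF mG B col0[OF e]] by simp
  qed
  have iff: "theta_const Q (lift_bits v) \<noteq> 0 \<longleftrightarrow> theta_length Q v \<noteq> 0" for Q :: "real^'g^'g" and v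
    by (simp add: theta_length_def)
  show "theta_support (riemann_matrix G l B) = column_mod2 B ` arcs G"
  proof
    show "column_mod2 B ` arcs G \<subseteq> theta_support (riemann_matrix G l B)"
      using col0 len mG by (force simp: theta_support_def iff metric_graph_def)
    show "theta_support (riemann_matrix G l B) \<subseteq> column_mod2 B ` arcs G"
    proof
      fix v assume "v \<in> theta_support (riemann_matrix G l B)"
      then have v: "v \<noteq> 0" "theta_length (riemann_matrix G l B) v \<noteq> 0"
        by (simp_all add: theta_support_def iff)
      have "(\<Sum>e\<in>arcs G. l e * of_bool (column_mod2 B e = v)) \<noteq> 0"
        using v(2) unfolding theta_length_riemann[OF mG B v(1)] .
      then obtain e where "e \<in> arcs G" "l e * of_bool (column_mod2 B e = v) \<noteq> 0"
        using sum.neutral[of "arcs G" "\<lambda>e. l e * of_bool (column_mod2 B e = v)"] by blast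
      then show "v \<in> column_mod2 B ` arcs G"
        by auto
    qed
  qed
qed

text \<open>
  The labels match the edges of \<open>G\<close> with those of \<open>G0\<close> so that both cycle lattices have the same
  shattered sets. They therefore agree up to signs, and a signed copy of \<open>B0\<close> is a cycle basis of \<open>G\<close>;
  the signs cancel in the Riemann matrix. A graph without a cycle basis of the expected size has
  an empty family of independent sets, by the definition of the cographic matroid, and so it carries no such labels.
\<close>

lemma theta_lengths_give_riemann_matrix:
  fixes B0 :: "'g::finite \<Rightarrow> 'f \<Rightarrow> int" and G :: "('v, 'e) pre_digraph" and G0 :: "('w, 'f) pre_digraph"
  assumes mG0: "metric_graph G0 l0" and B0: "cycle_basis G0 UNIV B0"
    and Q: "riemann_matrix G0 l0 B0 = Q"
    and inj: "inj_on (column_mod2 B0) (arcs G0)"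
    and len: "\<And>f. f \<in> arcs G0 \<Longrightarrow> theta_length Q (column_mod2 B0 f) = l0 f"
    and supp: "theta_support Q = column_mod2 B0 ` arcs G0"
    and lab: "theta_labelled_graph Q G lab"
  shows "has_riemann_matrix G (\<lambda>e. theta_length Q (lab e)) Q"
proof -
  let ?lab0 = "column_mod2 B0"
  have cG: "connected_graph G" and bij: "bij_betw lab (arcs G) (theta_support Q)"
    and rel: "relabel_matroid lab (cographic_matroid G) = theta_matroid Q"
    using lab by (simp_all add: theta_labelled_graph_def)
  have G: "fin_digraph G" and G0: "fin_digraph G0" and l0: "\<forall>f\<in>arcs G0. 0 < l0 f"
    using cG mG0 by (simp_all add: metric_graph_def connected_graph_def)
  interpret H: halving_lattice "arcs G" "H1 G"
    by (rule halving_lattice_H1[OF G])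
  interpret H0: halving_lattice "arcs G0" "H1 G0"
    by (rule halving_lattice_H1[OF G0])
  note fam = arg_cong[OF rel, of snd, unfolded relabel_matroid_def snd_conv]
  have "{} \<in> snd (theta_matroid Q)"
    by (simp add: theta_matroid_def represented_matroid_def)
  then have "snd (cographic_matroid G) \<noteq> {}"
    unfolding fam[symmetric] by blast
  then obtain B1 where B1: "cycle_basis G {..<genus G} B1"
    by (auto simp: cographic_matroid_def)
  have injl: "inj_on lab (arcs G)"
    using bij by (rule bij_betw_imp_inj_on)
  have indep: "shattered (H1 G) I \<longleftrightarrow> lab ` I \<in> snd (theta_matroid Q)" if I: "I \<subseteq> arcs G" for I
  proof -
    have "lab ` I \<in> (\<lambda>I. lab ` I) ` snd (cographic_matroid G) \<longleftrightarrow> I \<in> snd (cographic_matroid G)"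
    proof
      assume "lab ` I \<in> (\<lambda>I. lab ` I) ` snd (cographic_matroid G)"
      then obtain K where K: "lab ` I = lab ` K" "K \<in> snd (cographic_matroid G)"
        by (rule imageE)
      then have "K \<subseteq> arcs G"
        by (auto simp: cographic_matroid_def represented_matroid_def)
      then have "I = K"
        using K(1) I inj_on_image_eq_iff[OF injl] by blast
      then show "I \<in> snd (cographic_matroid G)"
        using K(2) by simp
    qed (rule imageI)
    then show ?thesis
      unfolding fam cographic_independent_iff_shattered[OF G B1 I] by simp
  qed
  define p where "p e = inv_into (arcs G0) ?lab0 (lab e)" for e
  have bij0: "bij_betw ?lab0 (arcs G0) (theta_support Q)"
    using inj supp by (simp add: bij_betw_def)
  have bijp: "bij_betw p (arcs G) (arcs G0)"
    using bij_betw_trans[OF bij bij_betw_inv_into[OF bij0]]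
    by (rule bij_betw_cong[THEN iffD1, rotated]) (simp add: p_def)
  have lab_p: "?lab0 (p e) = lab e" if "e \<in> arcs G" for e
    unfolding p_def using that bij_betwE[OF bij] supp by (intro f_inv_into_f) blast
  let ?L0 = "signed_pullback (\<lambda>_. 1) p (arcs G) ` H1 G0"
  have L0: "halving_lattice (arcs G) ?L0"
    by (rule halving_lattice_signed_pullback[OF H0.halving_lattice_axioms H.finite_E]) simp
  have same: "shattered ?L0 I \<longleftrightarrow> shattered (H1 G) I" if I: "I \<subseteq> arcs G" for I
  proof -
    have "inj_on p I"
      using bij_betw_imp_inj_on[OF bijp] I by (rule inj_on_subset)
    from shattered_signed_pullback[OF H0.halving_lattice_axioms H.finite_E _ I this]
    have "shattered ?L0 I \<longleftrightarrow> shattered (H1 G0) (p ` I)"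
      by simp
    moreover have "p ` I \<subseteq> arcs G0"
      using bij_betwE[OF bijp] I by blast
    moreover have "?lab0 ` p ` I = lab ` I"
      using lab_p I by (force simp: image_image)
    ultimately show ?thesis
      using indep[OF I] theta_independent_iff_shattered[OF G0 B0 _ inj supp]
      by metis
  qed
  have "\<exists>s :: 'e \<Rightarrow> int. (\<forall>a. \<bar>s a\<bar> = 1) \<and> H1 G = signed_pullback s id (arcs G) ` ?L0"
    by (rule lattice_determined_up_to_signs[OF L0 H.halving_lattice_axioms]) (rule same)
  then obtain s where "\<forall>e. \<bar>s e\<bar> = 1" and H1_eq: "H1 G = signed_pullback s id (arcs G) ` ?L0"
    by (elim exE conjE)
  then have s: "\<bar>s e\<bar> = 1" for e
    by (elim allE)
  define f where "f = signed_pullback s p (arcs G)"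
  have H1_f: "H1 G = f ` H1 G0"
    unfolding H1_eq image_image f_def by (intro image_cong refl) (simp add: signed_pullback_def fun_eq_iff)
  have "inj_on f (H1 G0)"
    unfolding f_def
    by (rule inj_on_signed_pullback[OF H0.halving_lattice_axioms s])
      (simp add: bij_betw_imp_surj_on[OF bijp])
  then have "lattice_basis (f ` H1 G0) UNIV (\<lambda>i. f (B0 i))"
  proof (rule lattice_basis_map[OF B0[unfolded cycle_basis_eq], rotated])
    show "f (\<lambda>e. \<Sum>j\<in>UNIV. c j * B0 j e) = (\<lambda>e. \<Sum>j\<in>UNIV. c j * f (B0 j) e)" for c
      by (rule ext) (simp add: f_def signed_pullback_def sum_distrib_left mult.left_commute)
    show "(\<lambda>e. \<Sum>j\<in>UNIV. c j * B0 j e) \<in> H1 G0" for c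
      by (rule H0.combination) (simp_all add: lattice_basis_mem[OF B0[unfolded cycle_basis_eq]])
  qed
  then have B: "cycle_basis G UNIV (\<lambda>i. f (B0 i))"
    by (simp add: cycle_basis_eq H1_f)
  have "(2 :: nat) ^ genus G = 2 ^ CARD('g)"
    using H.card_parities[OF B[unfolded cycle_basis_eq]] H.card_parities[OF B1[unfolded cycle_basis_eq]]
    by simp
  then have genus: "genus G = CARD('g)"
    by simp
  have len': "theta_length Q (lab e) = l0 (p e)" if "e \<in> arcs G" for e
    using len[of "p e"] lab_p[OF that] bij_betwE[OF bijp] that by simp
  have pos: "0 < theta_length Q (lab e)" if "e \<in> arcs G" for e
    using len'[OF that] l0 bij_betwE[OF bijp] that by simp
  have "riemann_matrix G (\<lambda>e. theta_length Q (lab e)) (\<lambda>i. f (B0 i)) = Q"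
  proof -
    have "(\<Sum>e\<in>arcs G. real_of_int (f (B0 i) e) * theta_length Q (lab e) * real_of_int (f (B0 j) e)) =
        (\<Sum>e\<in>arcs G0. real_of_int (B0 i e) * l0 e * real_of_int (B0 j e))" for i j
    proof -
      have "real_of_int (f (B0 i) e) * theta_length Q (lab e) * real_of_int (f (B0 j) e) =
          real_of_int (B0 i (p e)) * l0 (p e) * real_of_int (B0 j (p e))" if e: "e \<in> arcs G" for e
      proof -
        have "real_of_int (s e) * real_of_int (s e) = 1"
          using unit_square[OF s[of e]] by (metis of_int_1 of_int_mult)
        then show ?thesis
          using e by (simp add: f_def signed_pullback_def len' algebra_simps)
      qed
      then show ?thesis
        using sum.reindex_bij_betw[OF bijp, of "\<lambda>e. real_of_int (B0 i e) * l0 e * real_of_int (B0 j e)"]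
        by simp
    qed
    then show ?thesis
      unfolding Q[symmetric] riemann_matrix_def[of G] riemann_matrix_def[of G0] vec_eq_iff by (simp add: Q)
  qed
  then show ?thesis
    unfolding has_riemann_matrix_def metric_graph_def
    using cG pos genus B by auto
qed

theorem theorem4p2:
  fixes Q :: "real^'g^'g"
  assumes "Q \<in> tropical_schottky_locus"
  shows "(\<exists>(G :: (nat, nat) pre_digraph) lab. theta_labelled_graph Q G lab) \<and>
         (\<forall>(G :: ('v, 'e) pre_digraph) lab. theta_labelled_graph Q G lab \<longrightarrow>
            (\<forall>e\<in>arcs G. 0 < theta_length Q (lab e)) \<and>
            has_riemann_matrix G (\<lambda>e. theta_length Q (lab e)) Q)"
proof -
  from reduced_graph_exists[OF assms] obtain G0 :: "(nat, nat) pre_digraph" and l0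
    and B0 :: "'g \<Rightarrow> nat \<Rightarrow> int" where mG0: "metric_graph G0 l0" and genus: "genus G0 = CARD('g)"
    and B0: "cycle_basis G0 UNIV B0" and Q: "riemann_matrix G0 l0 B0 = Q"
    and red: "\<forall>e\<in>arcs G0. \<exists>i. odd (B0 i e)"
      "\<forall>e\<in>arcs G0. \<forall>f\<in>arcs G0. (\<forall>i. even (B0 i e) \<longleftrightarrow> even (B0 i f)) \<longrightarrow> e = f"
    by (elim exE conjE)
  note inj = inj_on_column_mod2[OF mG0 B0 red]
    and len = theta_length_column[OF mG0 B0 red, unfolded Q]
    and supp = theta_support_eq[OF mG0 B0 red, unfolded Q]
  have cG0: "connected_graph G0" and G0: "fin_digraph G0"
    using mG0 by (simp_all add: metric_graph_def connected_graph_def)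
  have "theta_labelled_graph Q G0 (column_mod2 B0)"
    unfolding theta_labelled_graph_def bij_betw_def
    using cG0 inj supp relabel_cographic_eq_theta_matroid[OF G0 B0 genus inj supp] by simp
  moreover have "has_riemann_matrix G (\<lambda>e. theta_length Q (lab e)) Q"
    if "theta_labelled_graph Q G lab" for G :: "('v, 'e) pre_digraph" and lab
    by (rule theta_lengths_give_riemann_matrix[OF mG0 B0 Q inj len supp that])
  ultimately show ?thesis
    by (auto simp: has_riemann_matrix_def metric_graph_def)
qed

end
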